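(* Let $\alpha>-1$ and let $\Phi,\Psi:\mathbb{D}\to\mathbb{D}$ be analytic. Consider the composition operators $C_\Phi$ and $C_\Psi$ on the weighted Bergman space $\mathcal{A}_\alpha^2(\mathbb{D})$. Then $C_\Phi C_\Psi^*$ is an isometry if and only if both $C_\Phi$ and $C_\Psi$ are isometries; equivalently, if and only if both $\Phi$ and $\Psi$ are rotations.
   Context: $\mathbb{D}=\{z\in\mathbb{C}:|z|<1\}$. For $\alpha>-1$, $\mathcal{A}_\alpha^2(\mathbb{D})$ is the Hilbert space of analytic functions $f:\mathbb{D}\to\mathbb{C}$ with $\|f\|_\alpha^2=\int_{\mathbb{D}}|f(z)|^2\,dA_\alpha(z)<\infty$, where $dA_\alpha(z)=(\alpha+1)(1-|z|^2)^\alpha\,dA(z)$ and $dA$ is area measure on $\mathbb{D}$ normalized so that $\mathbb{D}$ has measure $1$; the inner product is $\langle f,g\rangle=\int_{\mathbb{D}}f\overline{g}\,dA_\alpha$. For an analytic self-map $\Phi$ of $\mathbb{D}$, the composition operator is $C_\Phi f=f\circ\Phi$; it is a bounded operator on $\mathcal{A}_\alpha^2(\mathbb{D})$, and $C_\Phi^*$ denotes its Hilbert space adjoint. An operator $T$ is an isometry if $\|Tf\|_\alpha=\|f\|_\alpha$ for all $f$ (equivalently $T^*T=I$; surjectivity is not required). A rotation is a map $z\mapsto\lambda z$ on $\mathbb{D}$ with $\lambda\in\mathbb{C}$, $|\lambda|=1$. *)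

theory Defs
  imports "HOL-Complex_Analysis.Complex_Analysis"
begin

abbreviation unit_disc :: "complex set" ("\<D>")
  where "\<D> \<equiv> ball 0 1"

text \<open>The measure \<open>dA\<^sub>\<alpha> = (\<alpha> + 1) (1 - |z|\<^sup>2)\<^sup>\<alpha> dA\<close>; \<open>uniform_measure lborel \<D>\<close> is area measure
  restricted to the disc and normalised to total mass 1.\<close>

definition bergman_measure :: "real \<Rightarrow> complex measure"
  where "bergman_measure \<alpha> =
    density (uniform_measure lborel \<D>) (\<lambda>z. ennreal ((\<alpha> + 1) * (1 - (cmod z)\<^sup>2) powr \<alpha>))"

text \<open>A function \<open>\<D> \<rightarrow> \<complex>\<close> is represented by the total function that extends it by \<open>0\<close>, so that
  equality of elements of the space is equality of HOL functions.\<close>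

definition bergman_space :: "real \<Rightarrow> (complex \<Rightarrow> complex) set"
  where "bergman_space \<alpha> =
    {f. f holomorphic_on \<D> \<and> (\<forall>z. z \<notin> \<D> \<longrightarrow> f z = 0) \<and>
        integrable (bergman_measure \<alpha>) (\<lambda>z. (cmod (f z))\<^sup>2)}"

definition bergman_inner :: "real \<Rightarrow> (complex \<Rightarrow> complex) \<Rightarrow> (complex \<Rightarrow> complex) \<Rightarrow> complex"
  where "bergman_inner \<alpha> f g = (LINT z|bergman_measure \<alpha>. f z * cnj (g z))"

definition bergman_norm :: "real \<Rightarrow> (complex \<Rightarrow> complex) \<Rightarrow> real"
  where "bergman_norm \<alpha> f = sqrt (LINT z|bergman_measure \<alpha>. (cmod (f z))\<^sup>2)"

definition comp_op :: "(complex \<Rightarrow> complex) \<Rightarrow> (complex \<Rightarrow> complex) \<Rightarrow> complex \<Rightarrow> complex"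
  where "comp_op \<Phi> f = (\<lambda>z. if z \<in> \<D> then f (\<Phi> z) else 0)"

text \<open>The Hilbert space adjoint of a bounded operator \<open>T\<close> on the Bergman space; only its values
  on \<open>bergman_space \<alpha>\<close> are meaningful.\<close>

definition bergman_adjoint ::
    "real \<Rightarrow> ((complex \<Rightarrow> complex) \<Rightarrow> (complex \<Rightarrow> complex)) \<Rightarrow> (complex \<Rightarrow> complex) \<Rightarrow> (complex \<Rightarrow> complex)"
  where "bergman_adjoint \<alpha> T f =
    (THE g. g \<in> bergman_space \<alpha> \<and>
            (\<forall>h \<in> bergman_space \<alpha>. bergman_inner \<alpha> (T h) f = bergman_inner \<alpha> h g))"

definition bergman_isometry :: "real \<Rightarrow> ((complex \<Rightarrow> complex) \<Rightarrow> (complex \<Rightarrow> complex)) \<Rightarrow> bool"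
  where "bergman_isometry \<alpha> T \<longleftrightarrow>
    (\<forall>f \<in> bergman_space \<alpha>. T f \<in> bergman_space \<alpha> \<and> bergman_norm \<alpha> (T f) = bergman_norm \<alpha> f)"

definition is_rotation :: "(complex \<Rightarrow> complex) \<Rightarrow> bool"
  where "is_rotation \<Phi> \<longleftrightarrow> (\<exists>c. cmod c = 1 \<and> (\<forall>z \<in> \<D>. \<Phi> z = c * z))"

end

(* With K w the reproducing kernel, the adjoint of C_Psi maps K w to K (Psi w). Hence, if
   T = C_Phi C_Psi^* is an isometry, <K (Psi w) o Phi, K (Psi v) o Phi> = K w v for all v, w.
   Put a = Psi 0 and F u = <K a o Phi, K u o Phi>. Then F is holomorphic and equals 1 on the open
   set Psi(D), so F = 1; the values F 0 = F a = 1 give the equality case of Cauchy-Schwarz for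
   K a o Phi and 1, so K a o Phi = 1 and a = 0. Since Psi 0 = 0, the adjoint of C_Psi multiplies
   the coordinate function z by cnj (Psi' 0), so T z = cnj (Psi' 0) Phi. Orthogonality of z and 1
   gives Phi 0 = 0, and ||T z|| = ||z|| is then the equality case of the Schwarz lemma for both
   maps. The adjoint is only evaluated at explicit functions, so neither the Riesz representation
   theorem nor L^2-boundedness of C_Psi is needed: it suffices that C_Psi preserves integrability,
   which is a subordination argument with the Poisson kernel on circles of radius R, where
   1 - R^2 is a fixed multiple of 1 - |z|^2 (Schwarz-Pick), and with the fact that 1 - |z|^2 is
   uniformly distributed on (0, 1). *)
theory Submission
  imports Defs "HOL-Probability.Probability_Measure"
begin

section \<open>Lebesgue measure on the complex plane\<close>

text \<open>As \<open>bergman_adjoint\<close> is a definite description, it says something about a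
  function only after a value has been exhibited and shown to be unique. So T is not known to be
  linear in advance: each polarisation argument for T concerns a particular pair of functions with
  explicit adjoint values, namely kernels and the coordinate function. These are bounded, so
  integrability of \<open>comp_op \<Psi> h\<close> gives meaning to all pairings with them. The
  isometry identity controls F only on the image of \<Psi>, and the equality K a o \<Phi> = 1
  controls K a only on the image of \<Phi>. Both gaps are closed by the identity theorem, which
  wants open images; hence the proofs that neither map is constant. The kernel is a power series
  with coefficients \<open>1 / moment n\<close>, not the closed form (1 - cnj w z)^(-(\<alpha> +
  2)). The reproducing property is then a comparison of Taylor coefficients, supplied by rotation
  invariance, and convergence comes from the mass of the measure near the unit circle.\<close>

lemma nn_integral_lborel_complex:
  fixes F :: "complex \<Rightarrow> ennreal"
  assumes [measurable]: "F \<in> borel_measurable borel"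
  shows "(\<integral>\<^sup>+z. F z \<partial>lborel) = (\<integral>\<^sup>+y. \<integral>\<^sup>+x. F (Complex x y) \<partial>lborel \<partial>lborel)"
    and "(\<integral>\<^sup>+z. F z \<partial>lborel) = (\<integral>\<^sup>+x. \<integral>\<^sup>+y. F (Complex x y) \<partial>lborel \<partial>lborel)"
proof -
  let ?P = "lborel \<Otimes>\<^sub>M lborel :: (real \<times> real) measure"
  have cont: "continuous_on UNIV (\<lambda>p. Complex (fst p) (snd p))"
    unfolding Complex_eq by (intro continuous_intros)
  have [measurable]: "(\<lambda>p. Complex (fst p) (snd p)) \<in> ?P \<rightarrow>\<^sub>M borel"
    using borel_measurable_continuous_onI[OF cont] by (simp add: lborel_prod)
  \<comment> \<open>Lebesgue measure is determined by its values on boxes, and a complex box is a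
    product of two intervals; Tonelli in either order then finishes the proof.\<close>
  have "lborel = distr ?P borel (\<lambda>p. Complex (fst p) (snd p))"
  proof (rule lborel_eqI)
    fix l u :: complex
    assume le: "\<And>b. b \<in> Basis \<Longrightarrow> l \<bullet> b \<le> u \<bullet> b"
    then have le': "Re l \<le> Re u" "Im l \<le> Im u"
      using le[of 1] le[of \<i>] by (auto simp: Basis_complex_def)
    have "(\<lambda>p. Complex (fst p) (snd p)) -` box l u \<inter> space ?P
        = {Re l<..<Re u} \<times> {Im l<..<Im u}"
      by (auto simp: box_def Basis_complex_def space_pair_measure)
    then have "emeasure (distr ?P borel (\<lambda>p. Complex (fst p) (snd p))) (box l u)
        = emeasure ?P ({Re l<..<Re u} \<times> {Im l<..<Im u})"
      by (simp add: emeasure_distr)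
    also have "\<dots> = ennreal (Re u - Re l) * ennreal (Im u - Im l)"
      using le' by (simp add: lborel.emeasure_pair_measure_Times)
    finally show "emeasure (distr ?P borel (\<lambda>p. Complex (fst p) (snd p))) (box l u)
        = (\<Prod>b\<in>Basis. (u - l) \<bullet> b)"
      using le' by (simp add: Basis_complex_def ennreal_mult)
  qed simp
  then have "(\<integral>\<^sup>+z. F z \<partial>lborel)
      = (\<integral>\<^sup>+z. F z \<partial>distr ?P borel (\<lambda>p. Complex (fst p) (snd p)))"
    by (rule arg_cong)
  then have "(\<integral>\<^sup>+z. F z \<partial>lborel) = (\<integral>\<^sup>+p. F (Complex (fst p) (snd p)) \<partial>?P)"
    by (simp add: nn_integral_distr)
  moreover have "(\<lambda>(x, y). F (Complex x y)) \<in> borel_measurable ?P"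
    by (simp add: split_beta')
  ultimately show "(\<integral>\<^sup>+z. F z \<partial>lborel) = (\<integral>\<^sup>+y. \<integral>\<^sup>+x. F (Complex x y) \<partial>lborel \<partial>lborel)"
    "(\<integral>\<^sup>+z. F z \<partial>lborel) = (\<integral>\<^sup>+x. \<integral>\<^sup>+y. F (Complex x y) \<partial>lborel \<partial>lborel)"
    using lborel_pair.nn_integral_snd[of "\<lambda>(x, y). F (Complex x y)"]
      lborel.nn_integral_fst[of "\<lambda>(x, y). F (Complex x y)" lborel]
    by (auto simp: split_beta')
qed

lemma nn_integral_lborel_translate:
  fixes f :: "real \<Rightarrow> ennreal"
  assumes [measurable]: "f \<in> borel_measurable borel"
  shows "(\<integral>\<^sup>+x. f (x + t) \<partial>lborel) = (\<integral>\<^sup>+x. f x \<partial>lborel)"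
  using nn_integral_real_affine[of f 1 t] by (simp add: add.commute)

lemma measurable_Complex_pair [measurable (raw)]:
  assumes [measurable]: "f \<in> borel_measurable M" "g \<in> borel_measurable M"
  shows "(\<lambda>x. Complex (f x) (g x)) \<in> borel_measurable M"
  by (subst borel_measurable_complex_iff) simp

lemma measurable_Re_Im [measurable]: "Re \<in> borel_measurable borel" "Im \<in> borel_measurable borel"
  by (auto intro!: borel_measurable_continuous_onI continuous_intros)

text \<open>With the unsheared coordinate as outer variable, a shear is a translation of the inner
  integral. This is why both orders of integration are kept available.\<close>

lemma nn_integral_lborel_shear:
  fixes F :: "complex \<Rightarrow> ennreal"
  assumes [measurable]: "F \<in> borel_measurable borel"
  shows "(\<integral>\<^sup>+z. F (Complex (Re z + s * Im z) (Im z)) \<partial>lborel) = (\<integral>\<^sup>+z. F z \<partial>lborel)"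
    and "(\<integral>\<^sup>+z. F (Complex (Re z) (Im z + s * Re z)) \<partial>lborel) = (\<integral>\<^sup>+z. F z \<partial>lborel)"
proof -
  have m: "(\<lambda>x. F (Complex x y)) \<in> borel_measurable borel"
          "(\<lambda>x. F (Complex y x)) \<in> borel_measurable borel" for y by measurable
  show "(\<integral>\<^sup>+z. F (Complex (Re z + s * Im z) (Im z)) \<partial>lborel) = (\<integral>\<^sup>+z. F z \<partial>lborel)"
    using nn_integral_lborel_translate[OF m(1)]
    by (simp add: nn_integral_lborel_complex(1))
  show "(\<integral>\<^sup>+z. F (Complex (Re z) (Im z + s * Re z)) \<partial>lborel) = (\<integral>\<^sup>+z. F z \<partial>lborel)"
    using nn_integral_lborel_translate[OF m(2)]
    by (simp add: nn_integral_lborel_complex(2))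
qed

lemma nn_integral_lborel_rotate:
  fixes F :: "complex \<Rightarrow> ennreal"
  assumes [measurable]: "F \<in> borel_measurable borel" and c: "cmod c = 1"
  shows "(\<integral>\<^sup>+z. F (c * z) \<partial>lborel) = (\<integral>\<^sup>+z. F z \<partial>lborel)"
proof -
  \<comment> \<open>a rotation by an angle other than \<open>\<pi>\<close> is a product of three shears\<close>
  have main: "(\<integral>\<^sup>+z. F (c * z) \<partial>lborel) = (\<integral>\<^sup>+z. F z \<partial>lborel)"
    if [measurable]: "F \<in> borel_measurable borel" and c: "cmod c = 1" and ne: "c \<noteq> -1"
    for F :: "complex \<Rightarrow> ennreal" and c
  proof -
    \<comment> \<open>With c = cis \<theta>, t is tan (\<theta>/2); the three shears have
      coefficients -t, q = sin \<theta> and -t. The denominator 1 + p vanishes only at c =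
      -1.\<close>
    define p q t where "p = Re c" and "q = Im c" and "t = q / (1 + p)"
    have pq: "p\<^sup>2 + q\<^sup>2 = 1"
      using c by (simp add: p_def q_def cmod_def)
    have "p \<noteq> -1"
      using pq ne by (auto simp: p_def q_def complex_eq_iff)
    then have qt: "q * t = 1 - p" and tp: "t * (1 + p) = q"
      using pq by (auto simp: t_def field_simps power2_eq_square)
    have cz: "c * z = Complex (Re z - t * Im z - t * (Im z + q * (Re z - t * Im z)))
        (Im z + q * (Re z - t * Im z))" for z
    proof (rule complex_eqI)
      have "Im z + q * (Re z - t * Im z) = q * Re z + (1 - q * t) * Im z"
        by (simp add: algebra_simps)
      also have "\<dots> = p * Im z + q * Re z" by (simp add: qt)
      finally have 1: "Im z + q * (Re z - t * Im z) = p * Im z + q * Re z" .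
      then show "Im (c * z) = Im (Complex (Re z - t * Im z - t * (Im z + q * (Re z - t * Im z)))
        (Im z + q * (Re z - t * Im z)))"
        by (simp add: p_def q_def)
      have "Re z - t * Im z - t * (p * Im z + q * Re z)
          = (1 - q * t) * Re z - (t * (1 + p)) * Im z"
        by (simp add: algebra_simps)
      then show "Re (c * z) = Re (Complex (Re z - t * Im z - t * (Im z + q * (Re z - t * Im z)))
        (Im z + q * (Re z - t * Im z)))"
        unfolding 1 by (simp only: qt tp complex.sel) (simp add: p_def q_def)
    qed
    define G1 where "G1 = (\<lambda>z. F (Complex (Re z + (- t) * Im z) (Im z)))"
    define G2 where "G2 = (\<lambda>z. G1 (Complex (Re z) (Im z + q * Re z)))"
    have [measurable]: "G1 \<in> borel_measurable borel" "G2 \<in> borel_measurable borel"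
      unfolding G1_def G2_def by measurable
    have "(\<integral>\<^sup>+z. F (c * z) \<partial>lborel) = (\<integral>\<^sup>+z. G2 (Complex (Re z + (- t) * Im z) (Im z)) \<partial>lborel)"
      unfolding G2_def G1_def cz by simp
    also have "\<dots> = (\<integral>\<^sup>+z. G2 z \<partial>lborel)"
      by (rule nn_integral_lborel_shear) simp
    also have "\<dots> = (\<integral>\<^sup>+z. G1 z \<partial>lborel)"
      unfolding G2_def by (rule nn_integral_lborel_shear) simp
    also have "\<dots> = (\<integral>\<^sup>+z. F z \<partial>lborel)"
      unfolding G1_def by (rule nn_integral_lborel_shear) simp
    finally show ?thesis .
  qed
  show ?thesis
  proof (cases "c = -1")
    \<comment> \<open>The excluded half turn is two quarter turns, each covered by
      \<open>main\<close>.\<close>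
    case True
    have "(\<integral>\<^sup>+z. F (c * z) \<partial>lborel) = (\<integral>\<^sup>+z. F (\<i> * (\<i> * z)) \<partial>lborel)"
      by (simp add: True)
    also have "\<dots> = (\<integral>\<^sup>+z. F (\<i> * z) \<partial>lborel)"
      by (rule main[of "\<lambda>z. F (\<i> * z)"]) (auto simp: complex_eq_iff)
    also have "\<dots> = (\<integral>\<^sup>+z. F z \<partial>lborel)"
      by (rule main) (auto simp: complex_eq_iff)
    finally show ?thesis .
  qed (use main c in auto)
qed

section \<open>The weighted measure on the disc\<close>

lemma emeasure_unit_disc: "emeasure lborel \<D> = ennreal pi"
  by (simp add: emeasure_ball unit_ball_vol_2)

lemma nn_integral_uniform_disc:
  fixes F :: "complex \<Rightarrow> ennreal"
  assumes [measurable]: "F \<in> borel_measurable borel"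
  shows "(\<integral>\<^sup>+z. F z \<partial>uniform_measure lborel \<D>) = (\<integral>\<^sup>+z. F z * indicator \<D> z \<partial>lborel) / ennreal pi"
  by (simp add: nn_integral_uniform_measure emeasure_unit_disc)

text \<open>The disc of radius r has normalised area r^2, so the squared modulus is uniform on the
  unit interval, and so is its complement to 1. Comparing the two measures on half-lines suffices.
  Radial integrals thereby become integrals over (0, 1] against a power of s.\<close>

lemma distr_uniform_disc:
  "distr (uniform_measure lborel \<D>) borel (\<lambda>z. 1 - (cmod z)\<^sup>2) = uniform_measure lborel {0<..1::real}"
proof (rule measure_eqI_lessThan)
  fix x :: real
  have eq: "emeasure (distr (uniform_measure lborel \<D>) borel (\<lambda>z. 1 - (cmod z)\<^sup>2)) {x<..}
      = emeasure lborel (\<D> \<inter> {z. x < 1 - (cmod z)\<^sup>2}) / ennreal pi"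
    by (subst emeasure_distr) (simp_all add: vimage_def emeasure_unit_disc)
  consider "x < 0" | "0 \<le> x" "x < 1" | "x \<ge> 1" by linarith
  then have "emeasure lborel (\<D> \<inter> {z. x < 1 - (cmod z)\<^sup>2}) / ennreal pi
      = emeasure lborel ({0<..1} \<inter> {x<..})"
  proof cases
    case 1
    have "\<D> \<inter> {z. x < 1 - (cmod z)\<^sup>2} = \<D>"
    proof -
      have "(cmod z)\<^sup>2 < 1 - x" if "cmod z < 1" for z
        using that 1 power_mono[of "cmod z" 1 2] by simp
      then show ?thesis by fastforce
    qed
    moreover have "{0<..1} \<inter> {x<..} = {0<..1}" using 1 by auto
    ultimately show ?thesis 
      by (simp add: emeasure_unit_disc ennreal_divide_self)
  next
    case 2
    have iff: "x < 1 - (cmod z)\<^sup>2 \<longleftrightarrow> cmod z < sqrt (1 - x)" for z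
      using real_less_rsqrt[of "cmod z" "1 - x"] real_sqrt_less_iff[of "(cmod z)\<^sup>2" "1 - x"]
      by (auto simp: algebra_simps)
    have "sqrt (1 - x) \<le> 1" using 2 by simp
    then have "ball 0 (sqrt (1 - x)) \<subseteq> \<D>" by (rule subset_ball)
    then have "\<D> \<inter> {z. x < 1 - (cmod z)\<^sup>2} = ball 0 (sqrt (1 - x))"
      by (auto simp: iff)
    moreover have "{0<..1} \<inter> {x<..} = {x<..1}" using 2 by auto
    moreover have "ennreal (pi * (1 - x)) / ennreal pi = ennreal (1 - x)"
      using 2 by (subst divide_ennreal) auto
    ultimately show ?thesis using 2
      by (simp add: emeasure_ball unit_ball_vol_2)
  next
    case 3
    have "\<not> x < 1 - (cmod z)\<^sup>2" for z
      using 3 zero_le_power2[of "cmod z"] by linarith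
    moreover have "{0<..1} \<inter> {x<..} = {}" using 3 by auto
    ultimately show ?thesis by simp
  qed
  also have "\<dots> = emeasure (uniform_measure lborel {0<..1}) {x<..}"
    by (simp add: divide_ennreal_def)
  finally show eq2: "emeasure (distr (uniform_measure lborel \<D>) borel (\<lambda>z. 1 - (cmod z)\<^sup>2)) {x<..}
      = emeasure (uniform_measure lborel {0<..1::real}) {x<..}"
    using eq by simp
  have "emeasure (uniform_measure lborel {0<..1}) {x<..} = emeasure lborel ({0<..1} \<inter> {x<..})"
    by (simp add: divide_ennreal_def)
  also have "\<dots> \<le> emeasure lborel {0<..1::real}"
    by (intro emeasure_mono) auto
  also have "\<dots> < \<infinity>" by simp
  finally show "emeasure (distr (uniform_measure lborel \<D>) borel (\<lambda>z. 1 - (cmod z)\<^sup>2)) {x<..} < \<infinity>"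
    using eq2 by simp
qed simp_all

lemma sets_bergman_measure [simp, measurable_cong]: "sets (bergman_measure \<alpha>) = sets borel"
  by (simp add: bergman_measure_def)

lemma space_bergman_measure [simp]: "space (bergman_measure \<alpha>) = UNIV"
  by (simp add: bergman_measure_def)

lemma nn_integral_bergman:
  assumes [measurable]: "F \<in> borel_measurable borel"
  shows "(\<integral>\<^sup>+z. F z \<partial>bergman_measure \<alpha>) = (\<integral>\<^sup>+z. ennreal ((\<alpha> + 1) * (1 - (cmod z)\<^sup>2) powr \<alpha>)
     * F z * indicator \<D> z \<partial>lborel) / ennreal pi"
  unfolding bergman_measure_def
  by (simp add: nn_integral_density nn_integral_uniform_disc)

lemma nn_integral_bergman_radial:
  assumes [measurable]: "g \<in> borel_measurable borel"
  shows "(\<integral>\<^sup>+z. g (1 - (cmod z)\<^sup>2) \<partial>bergman_measure \<alpha>)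
    = (\<integral>\<^sup>+s. ennreal ((\<alpha> + 1) * s powr \<alpha>) * g s * indicator {0<..1} s \<partial>lborel)"
proof -
  have "(\<integral>\<^sup>+z. g (1 - (cmod z)\<^sup>2) \<partial>bergman_measure \<alpha>)
     = (\<integral>\<^sup>+s. ennreal ((\<alpha> + 1) * s powr \<alpha>) * g s
          \<partial>distr (uniform_measure lborel \<D>) borel (\<lambda>z. 1 - (cmod z)\<^sup>2))"
    unfolding bergman_measure_def by (simp add: nn_integral_density nn_integral_distr)
  then show ?thesis
    by (simp add: distr_uniform_disc nn_integral_uniform_measure divide_ennreal_def)
qed

text \<open>In the variable s = 1 - |z|^2 the total mass is the integral of (\<alpha> + 1)
  s^\<alpha> over (0, 1].\<close>

lemma prob_space_bergman:
  assumes "\<alpha> > -1"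
  shows "prob_space (bergman_measure \<alpha>)"
proof
  have "(\<integral>\<^sup>+s. ennreal (indicator {0..1} s * s powr \<alpha>) \<partial>lborel) = ennreal (1 / (\<alpha> + 1))"
    using nn_integral_has_integral_lebesgue[OF _ has_integral_powr_from_0[OF assms, of 1]] by simp
  then have "1 = ennreal (\<alpha> + 1) * (\<integral>\<^sup>+s. ennreal (indicator {0..1} s * s powr \<alpha>) \<partial>lborel)"
    using assms by (simp add: ennreal_mult[symmetric])
  also have "\<dots> = (\<integral>\<^sup>+s. ennreal ((\<alpha> + 1) * s powr \<alpha>) * 1 * indicator {0<..1} s \<partial>lborel)"
    using assms
    by (subst nn_integral_cmult[symmetric], simp)
      (intro nn_integral_cong, auto simp: indicator_def ennreal_mult)
  also have "\<dots> = (\<integral>\<^sup>+z. 1 \<partial>bergman_measure \<alpha>)"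
    by (subst nn_integral_bergman_radial) simp_all
  finally show "emeasure (bergman_measure \<alpha>) (space (bergman_measure \<alpha>)) = 1"
    by simp
qed

lemma AE_bergman_disc: "AE z in bergman_measure \<alpha>. z \<in> \<D>"
  unfolding bergman_measure_def
  by (subst AE_density, simp) (auto simp: AE_uniform_measure emeasure_unit_disc)

text \<open>The density is strictly positive inside the disc, so a null set contains no nonempty
  open set. This is how almost-everywhere statements are turned into statements about
  points.\<close>

lemma AE_bergman_open:
  assumes "\<alpha> > -1" "AE z in bergman_measure \<alpha>. P z" "open U" "U \<subseteq> \<D>" "U \<noteq> {}"
  shows "\<exists>z\<in>U. P z"
proof (rule ccontr)
  assume "\<not> ?thesis"
  then have "AE z in bergman_measure \<alpha>. z \<notin> U"
    using assms(2) by (auto elim: eventually_mono)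
  then have "AE z in lborel. z \<in> \<D> \<longrightarrow> 0 < (\<alpha> + 1) * (1 - (cmod z)\<^sup>2) powr \<alpha> \<longrightarrow> z \<notin> U"
    unfolding bergman_measure_def using \<open>open U\<close>
    by (subst (asm) AE_density, simp) (simp add: AE_uniform_measure emeasure_unit_disc)
  then have "AE z in lborel. z \<notin> U"
  proof (eventually_elim, intro notI)
    fix z assume *: "z \<in> \<D> \<longrightarrow> 0 < (\<alpha> + 1) * (1 - (cmod z)\<^sup>2) powr \<alpha> \<longrightarrow> z \<notin> U" "z \<in> U"
    then have "cmod z < 1" using \<open>U \<subseteq> \<D>\<close> by auto
    then have "(cmod z)\<^sup>2 < 1" by (simp add: power_less_one_iff)
    then show False using * assms(1,4) by auto
  qed
  then have "negligible U"
    using \<open>open U\<close> by (simp add: negligible_iff_null_sets AE_iff_null_sets[symmetric] null_sets_completionI)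
  then show False using open_not_negligible assms by blast
qed

section \<open>Rotation invariance and averages over rotations\<close>

lemma nn_integral_bergman_rotate:
  assumes [measurable]: "F \<in> borel_measurable borel" and c: "cmod c = 1"
  shows "(\<integral>\<^sup>+z. F (c * z) \<partial>bergman_measure \<alpha>) = (\<integral>\<^sup>+z. F z \<partial>bergman_measure \<alpha>)"
proof -
  let ?G = "\<lambda>z. ennreal ((\<alpha> + 1) * (1 - (cmod z)\<^sup>2) powr \<alpha>) * F z * indicator \<D> z"
  have [measurable]: "\<D> \<in> sets borel" by simp
  have [measurable]: "?G \<in> borel_measurable borel"
    by measurable
  have "(\<integral>\<^sup>+z. F (c * z) \<partial>bergman_measure \<alpha>) = (\<integral>\<^sup>+z. ?G (c * z) \<partial>lborel) / ennreal pi"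
    by (simp add: nn_integral_bergman norm_mult c indicator_def)
  also have "\<dots> = (\<integral>\<^sup>+z. F z \<partial>bergman_measure \<alpha>)"
    by (subst nn_integral_lborel_rotate[OF _ c]) (simp_all add: nn_integral_bergman)
  finally show ?thesis .
qed

lemma distr_bergman_rotate:
  assumes c: "cmod c = 1"
  shows "distr (bergman_measure \<alpha>) borel (\<lambda>z. c * z) = bergman_measure \<alpha>"
proof (rule measure_eqI)
  fix A assume "A \<in> sets (distr (bergman_measure \<alpha>) borel (\<lambda>z. c * z))"
  then have [measurable]: "A \<in> sets borel" by simp
  have "emeasure (distr (bergman_measure \<alpha>) borel (\<lambda>z. c * z)) A
     = (\<integral>\<^sup>+z. indicator A z \<partial>distr (bergman_measure \<alpha>) borel (\<lambda>z. c * z))"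
    by simp
  also have "\<dots> = (\<integral>\<^sup>+z. indicator A (c * z) \<partial>bergman_measure \<alpha>)"
    by (subst nn_integral_distr) simp_all
  also have "\<dots> = (\<integral>\<^sup>+z. indicator A z \<partial>bergman_measure \<alpha>)"
    by (rule nn_integral_bergman_rotate) (use c in simp_all)
  finally show "emeasure (distr (bergman_measure \<alpha>) borel (\<lambda>z. c * z)) A = emeasure (bergman_measure \<alpha>) A"
    by simp
qed simp

lemma integral_bergman_rotate:
  fixes F :: "complex \<Rightarrow> 'a :: {banach, second_countable_topology}"
  assumes F: "F \<in> borel_measurable (bergman_measure \<alpha>)" and c: "cmod c = 1"
  shows "(LINT z|bergman_measure \<alpha>. F (c * z)) = (LINT z|bergman_measure \<alpha>. F z)"
    and "integrable (bergman_measure \<alpha>) (\<lambda>z. F (c * z)) \<longleftrightarrow> integrable (bergman_measure \<alpha>) F"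
proof -
  have F': "F \<in> borel_measurable borel" using F by simp
  have m: "(\<lambda>z. c * z) \<in> bergman_measure \<alpha> \<rightarrow>\<^sub>M borel" by simp
  show "(LINT z|bergman_measure \<alpha>. F (c * z)) = (LINT z|bergman_measure \<alpha>. F z)"
    using integral_distr[OF m F'] by (simp add: distr_bergman_rotate[OF c])
  show "integrable (bergman_measure \<alpha>) (\<lambda>z. F (c * z)) \<longleftrightarrow> integrable (bergman_measure \<alpha>) F"
    using integrable_distr_eq[OF m F'] by (simp add: distr_bergman_rotate[OF c])
qed

text \<open>The parameter interval is that of \<open>circlepath\<close>, and total mass 1 makes
  integrals over it mean values.\<close>

abbreviation circle_measure :: "real measure"
  where "circle_measure \<equiv> uniform_measure lborel {0..1}"

lemma prob_space_circle_measure: "prob_space circle_measure"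
  by (rule prob_space_uniform_measure) simp_all

lemma measurable_cis [measurable]: "cis \<in> borel_measurable borel"
  by (intro borel_measurable_continuous_onI continuous_intros)

text \<open>Every rotation leaves the integral unchanged, so it may be averaged over all of them;
  Tonelli moves the average inside. Formulas on a single circle then yield statements about the
  disc.\<close>

lemma nn_integral_bergman_average:
  assumes \<alpha>: "\<alpha> > -1" and [measurable]: "F \<in> borel_measurable borel"
  shows "(\<integral>\<^sup>+z. F z \<partial>bergman_measure \<alpha>)
    = (\<integral>\<^sup>+z. \<integral>\<^sup>+t. F (cis (2 * pi * t) * z) \<partial>circle_measure \<partial>bergman_measure \<alpha>)"
proof -
  interpret M: prob_space "bergman_measure \<alpha>" by (rule prob_space_bergman[OF \<alpha>])
  interpret C: prob_space circle_measure by (rule prob_space_circle_measure)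
  interpret pair_sigma_finite circle_measure "bergman_measure \<alpha>" ..
  have "(\<integral>\<^sup>+z. F z \<partial>bergman_measure \<alpha>)
     = (\<integral>\<^sup>+t. \<integral>\<^sup>+z. F (cis (2 * pi * t) * z) \<partial>bergman_measure \<alpha> \<partial>circle_measure)"
    by (simp add: nn_integral_bergman_rotate C.emeasure_space_1[simplified])
  also have "\<dots> = (\<integral>\<^sup>+z. \<integral>\<^sup>+t. F (cis (2 * pi * t) * z) \<partial>circle_measure \<partial>bergman_measure \<alpha>)"
    by (rule Fubini'[symmetric]) measurable
  finally show ?thesis .
qed

lemma integral_bergman_average:
  fixes F :: "complex \<Rightarrow> complex"
  assumes \<alpha>: "\<alpha> > -1" and F: "integrable (bergman_measure \<alpha>) F"
  shows "(LINT z|bergman_measure \<alpha>. F z)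
    = (LINT z|bergman_measure \<alpha>. LINT t|circle_measure. F (cis (2 * pi * t) * z))"
proof -
  interpret M: prob_space "bergman_measure \<alpha>" by (rule prob_space_bergman[OF \<alpha>])
  interpret C: prob_space circle_measure by (rule prob_space_circle_measure)
  interpret pair_sigma_finite circle_measure "bergman_measure \<alpha>" ..
  have [measurable]: "F \<in> borel_measurable borel" using F by auto
  have "integrable (circle_measure \<Otimes>\<^sub>M bergman_measure \<alpha>) (\<lambda>(t, z). F (cis (2 * pi * t) * z))"
  proof (rule integrableI_bounded)
    have "(\<integral>\<^sup>+x. ennreal (norm (case x of (t, z) \<Rightarrow> F (cis (2 * pi * t) * z)))
           \<partial>(circle_measure \<Otimes>\<^sub>M bergman_measure \<alpha>))
        = (\<integral>\<^sup>+t. \<integral>\<^sup>+z. norm (F (cis (2 * pi * t) * z)) \<partial>bergman_measure \<alpha> \<partial>circle_measure)"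
      by (subst M.nn_integral_fst[symmetric]) simp_all
    also have "\<dots> = (\<integral>\<^sup>+z. norm (F z) \<partial>bergman_measure \<alpha>)"
      by (subst nn_integral_bergman_rotate[of "\<lambda>z. ennreal (norm (F z))"])
        (simp_all add: C.emeasure_space_1[simplified])
    also have "\<dots> < \<infinity>" using F by (simp add: integrable_iff_bounded)
    finally show "(\<integral>\<^sup>+x. ennreal (norm (case x of (t, z) \<Rightarrow> F (cis (2 * pi * t) * z)))
           \<partial>(circle_measure \<Otimes>\<^sub>M bergman_measure \<alpha>)) < \<infinity>" .
  qed simp
  from Fubini_integral[OF this] show ?thesis
    by (simp add: integral_bergman_rotate C.prob_space[simplified])
qed

section \<open>Cauchy and Poisson formulas on circles\<close>

text \<open>Bridge from the gauge integrals in which contour integrals are expressed to the Lebesgue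
  integrals used for the measures.\<close>

lemma circle_measure_has_integral:
  fixes u :: "real \<Rightarrow> 'a :: euclidean_space"
  assumes [measurable]: "u \<in> borel_measurable borel" and c: "continuous_on {0..1} u"
    and I: "(u has_integral I) {0..1}"
  shows "integrable circle_measure u" "(LINT t|circle_measure. u t) = I"
proof -
  have eq: "circle_measure = density lborel (\<lambda>x. ennreal (indicator {0..1} x))"
    by (simp add: uniform_measure_def ennreal_indicator divide_ennreal_def)
  have s: "set_integrable lborel {0..1} u"
    by (rule borel_integrable_atLeastAtMost') fact
  then show "integrable circle_measure u"
    unfolding eq by (subst integrable_density) (auto simp: set_integrable_def)
  have "(LINT t|circle_measure. u t) = (LINT t:{0..1}|lborel. u t)"
    unfolding eq by (subst integral_density) (auto simp: set_lebesgue_integral_def)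
  also have "\<dots> = I"
    using set_borel_integral_eq_integral(2)[OF s] I by (simp add: integral_unique)
  finally show "(LINT t|circle_measure. u t) = I" .
qed

lemma continuous_on_cis [continuous_intros]:
  "continuous_on S f \<Longrightarrow> continuous_on S (\<lambda>t. cis (f t))"
  unfolding cis_conv_exp by (intro continuous_intros)

text \<open>The derivative of the circle path is 2 pi i times the point itself, so 2 pi i cancels
  and a mean value remains.\<close>

lemma has_contour_integral_circlepath_cis:
  assumes "(f has_contour_integral 2 * of_real pi * \<i> * I) (circlepath 0 r)"
  shows "((\<lambda>t. f (r * cis (2 * pi * t)) * (r * cis (2 * pi * t))) has_integral I) {0..1}"
proof -
  have e: "exp (2 * of_real pi * \<i> * of_real t) = cis (2 * pi * t)" for t
    by (simp add: cis_conv_exp mult_ac)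
  have "((\<lambda>t. f (r * cis (2 * pi * t)) * (2 * pi * \<i> * r * cis (2 * pi * t)))
      has_integral 2 * of_real pi * \<i> * I) {0..1}"
    using assms unfolding has_contour_integral_def
    by (rule has_integral_eq[rotated])
      (simp add: vector_derivative_circlepath01, simp add: circlepath e[symmetric])
  from has_integral_mult_right[OF this, of "1 / (2 * of_real pi * \<i>)"]
  show ?thesis by (simp add: mult_ac)
qed

lemma disc_mean_value:
  assumes "f holomorphic_on cball 0 1"
  shows "((\<lambda>t. f (cis (2 * pi * t))) has_integral f 0) {0..1}"
proof -
  have "((\<lambda>t. f (cis (2 * pi * t)) / cis (2 * pi * t) * cis (2 * pi * t)) has_integral f 0) {0..1}"
    using has_contour_integral_circlepath_cis[OF Cauchy_integral_circlepath_simple[OF assms, of 0]]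
    by simp
  then show ?thesis by simp
qed

text \<open>Cauchy's coefficient formula for u |-> f (z u) on the unit circle, where dividing by u^n
  is multiplying by cnj u ^ n. The extra factor cnj z ^ n turns z^n into |z|^(2n). Integrated over
  the disc, this isolates one Taylor coefficient.\<close>

lemma disc_Taylor_coeff:
  assumes f: "f holomorphic_on \<D>" and z: "z \<in> \<D>"
  shows "((\<lambda>t. f (cis (2 * pi * t) * z) * cnj (cis (2 * pi * t) * z) ^ n)
     has_integral (deriv ^^ n) f 0 / fact n * of_real (cmod z ^ (2 * n))) {0..1}"
proof -
  \<comment> \<open>Since |z| < 1, the dilated function is holomorphic beyond the closed unit disc;
    S is the open set on which the derivatives of the composition are computed.\<close>
  define S where "S = {u. u * z \<in> \<D>}"
  have "open S"
  proof -
    have "continuous_on UNIV (\<lambda>u. u * z)" by (intro continuous_intros)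
    from open_vimage[OF open_ball[of 0 1] this] show ?thesis by (simp add: S_def vimage_def)
  qed
  have sub: "cball 0 1 \<subseteq> S"
  proof
    fix u :: complex assume "u \<in> cball 0 1"
    then have "cmod u * cmod z \<le> cmod z" by (simp add: mult_left_le_one_le)
    also have "\<dots> < 1" using z by simp
    finally show "u \<in> S" by (simp add: S_def norm_mult)
  qed
  have holS: "(\<lambda>u. f (z * u)) holomorphic_on S"
    by (rule holomorphic_on_compose_gen[OF _ f, unfolded o_def])
      (auto simp: S_def mult.commute intro!: holomorphic_intros)
  then have hol: "(\<lambda>u. f (z * u)) holomorphic_on cball 0 1"
    using sub by (rule holomorphic_on_subset)
  have "(deriv ^^ n) (\<lambda>u. f (z * u)) 0 = z ^ n * (deriv ^^ n) f (z * 0)"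
    using sub by (intro higher_deriv_compose_linear[OF f \<open>open S\<close>]) (auto simp: S_def mult.commute)
  then have "((\<lambda>u. f (z * u) / u ^ Suc n) has_contour_integral
      2 * of_real pi * \<i> * (z ^ n * (deriv ^^ n) f 0 / fact n)) (circlepath 0 1)"
    using Cauchy_has_contour_integral_higher_derivative_circlepath[of 0 1 "\<lambda>u. f (z * u)" 0 n]
      holomorphic_on_imp_continuous_on[OF hol] holomorphic_on_subset[OF hol ball_subset_cball]
    by simp
  from has_integral_mult_right[OF has_contour_integral_circlepath_cis[OF this], of "cnj z ^ n"]
  have "((\<lambda>t. cnj z ^ n * (f (z * cis (2 * pi * t)) / cis (2 * pi * t) ^ Suc n * cis (2 * pi * t)))
      has_integral (cnj z ^ n * (z ^ n * (deriv ^^ n) f 0 / fact n))) {0..1}"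
    by simp
  moreover have "cnj z ^ n * (z ^ n * (deriv ^^ n) f 0 / fact n)
      = (deriv ^^ n) f 0 / fact n * of_real (cmod z ^ (2 * n))"
  proof -
    have "cnj z ^ n * z ^ n = (cnj z * z) ^ n" by (simp only: power_mult_distrib)
    also have "cnj z * z = of_real ((cmod z)\<^sup>2)"
      using complex_norm_square[of z] by (simp add: mult.commute)
    finally have *: "cnj z ^ n * z ^ n = of_real (cmod z ^ (2 * n))"
      by (simp add: power_mult)
    have "cnj z ^ n * (z ^ n * (deriv ^^ n) f 0 / fact n)
        = (deriv ^^ n) f 0 / fact n * (cnj z ^ n * z ^ n)" by simp
    then show ?thesis unfolding * .
  qed
  moreover have "cnj z ^ n * (f (z * cis x) / cis x ^ Suc n * cis x)
      = f (cis x * z) * cnj (cis x * z) ^ n" for x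
  proof -
    have "cnj (cis x * z) ^ n = cnj z ^ n / cis x ^ n"
      by (simp add: power_mult_distrib cis_cnj cis_inverse[symmetric] power_inverse divide_inverse
          del: cis_inverse)
    then show ?thesis 
      by (simp add: mult.commute)
  qed
  ultimately show ?thesis by (simp only:)
qed

text \<open>The radius of the circle is read off from \<zeta>, so one definition serves all
  radii.\<close>

definition poisson :: "complex \<Rightarrow> complex \<Rightarrow> real"
  where "poisson w \<zeta> = ((cmod \<zeta>)\<^sup>2 - (cmod w)\<^sup>2) / (cmod (\<zeta> - w))\<^sup>2"

text \<open>As the real part of a function holomorphic in w, the kernel obeys the mean value
  property when w is replaced by values of a holomorphic map.\<close>

lemma poisson_eq_Re: "poisson w \<zeta> = Re ((\<zeta> + w) / (\<zeta> - w))"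
  unfolding poisson_def
  by (subst Re_divide, subst cmod_power2[of "\<zeta> - w"], rule arg_cong[where f = "\<lambda>x. x / _"])
    (simp add: cmod_power2, simp add: power2_eq_square algebra_simps)

lemma poisson_nonneg: "cmod w \<le> cmod \<zeta> \<Longrightarrow> poisson w \<zeta> \<ge> 0"
  unfolding poisson_def by (simp add: power_mono)

lemma poisson_le:
  assumes "cmod w < cmod \<zeta>"
  shows "poisson w \<zeta> \<le> (cmod \<zeta> + cmod w) / (cmod \<zeta> - cmod w)"
proof -
  have "cmod \<zeta> - cmod w \<le> cmod (\<zeta> - w)" by (rule norm_triangle_ineq2)
  then have "(cmod \<zeta> - cmod w)\<^sup>2 \<le> (cmod (\<zeta> - w))\<^sup>2"
    using assms by (intro power_mono) auto
  then have "poisson w \<zeta> \<le> ((cmod \<zeta>)\<^sup>2 - (cmod w)\<^sup>2) / (cmod \<zeta> - cmod w)\<^sup>2"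
    unfolding poisson_def using assms
    by (intro divide_left_mono) (auto intro!: power_mono mult_pos_pos)
  also have "\<dots> = (cmod \<zeta> + cmod w) / (cmod \<zeta> - cmod w)"
  proof -
    have "(cmod \<zeta>)\<^sup>2 - (cmod w)\<^sup>2 = (cmod \<zeta> + cmod w) * (cmod \<zeta> - cmod w)"
      by (simp add: power2_eq_square algebra_simps)
    then show ?thesis using assms by (simp only: power2_eq_square) simp
  qed
  finally show ?thesis .
qed

lemma poisson_formula:
  assumes h: "h holomorphic_on cball 0 R" and w: "cmod w < R"
  shows "((\<lambda>t. h (R * cis (2 * pi * t)) * of_real (poisson w (R * cis (2 * pi * t))))
     has_integral h w) {0..1}"
proof -
  have R: "0 < R" using w by (rule le_less_trans[OF norm_ge_zero])
  have ne: "(of_real R)\<^sup>2 - cnj w * u \<noteq> 0" if "cmod u \<le> R" for u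
  proof
    assume "(of_real R)\<^sup>2 - cnj w * u = 0"
    then have "cmod ((of_real R)\<^sup>2) = cmod (cnj w * u)" by simp
    then have "R * R = cmod w * cmod u"
      using R by (simp add: norm_mult power2_eq_square)
    moreover have "cmod w * cmod u \<le> cmod w * R" using that by (simp add: mult_left_mono)
    moreover have "cmod w * R < R * R" using w R by simp
    ultimately show False by linarith
  qed
  \<comment> \<open>The extra factor is holomorphic on the closed disc and equals 1 at w. On the
    circle R^2 = u * cnj u, and there it converts the Cauchy kernel of h into the Poisson kernel, so
    Cauchy's formula for H is Poisson's formula for h.\<close>
  define H where "H = (\<lambda>u. h u * (((of_real R)\<^sup>2 - (of_real (cmod w))\<^sup>2) / ((of_real R)\<^sup>2 - cnj w * u)))"
  have "H holomorphic_on cball 0 R"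
    unfolding H_def by (intro holomorphic_intros h) (use ne in \<open>simp add: dist_norm\<close>)
  moreover have "H w = h w"
  proof -
    have "cnj w * w = (of_real (cmod w))\<^sup>2"
      using complex_norm_square[of w] by (simp add: mult.commute)
    then show ?thesis using ne[of w] w unfolding H_def by simp
  qed
  ultimately have "((\<lambda>u. H u / (u - w)) has_contour_integral 2 * of_real pi * \<i> * h w) (circlepath 0 R)"
    using Cauchy_integral_circlepath_simple[of H 0 R w] w by simp
  from has_contour_integral_circlepath_cis[OF this]
  have "((\<lambda>t. H (R * cis (2 * pi * t)) / (R * cis (2 * pi * t) - w) * (R * cis (2 * pi * t)))
      has_integral h w) {0..1}" .
  moreover have "H u / (u - w) * u = h u * of_real (poisson w u)" if "u = R * cis x" for u x
  proof -
    have u: "cmod u = R" using R that by (simp add: norm_mult)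
    have uw: "u \<noteq> w" "u \<noteq> 0" using u w R by auto
    have 1: "(of_real R)\<^sup>2 - cnj w * u = u * cnj (u - w)"
      using complex_norm_square[of u] u by (simp add: algebra_simps)
    have 2: "complex_of_real ((cmod (u - w))\<^sup>2) = (u - w) * cnj (u - w)"
      using complex_norm_square[of "u - w"] by simp
    have 3: "a * (N / (u * c)) / d * u = a * (N / (d * c))" for a N c d
      using uw(2) by simp
    show ?thesis
      unfolding H_def poisson_def 1 of_real_divide 2 u 3 by simp
  qed
  ultimately show ?thesis by simp
qed

section \<open>Averages of a composition over circles\<close>

text \<open>Dropping one endpoint lets translated period intervals be cut and reassembled without
  overlap.\<close>

lemma nn_integral_circle_measure:
  assumes [measurable]: "f \<in> borel_measurable borel"
  shows "(\<integral>\<^sup>+t. f t \<partial>circle_measure) = (\<integral>\<^sup>+t. f t * indicator {0..<1} t \<partial>lborel)"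
proof -
  have "(\<integral>\<^sup>+t. f t \<partial>circle_measure) = (\<integral>\<^sup>+t. f t * indicator {0..1} t \<partial>lborel)"
    by (simp add: nn_integral_uniform_measure divide_ennreal_def)
  also have "\<dots> = (\<integral>\<^sup>+t. f t * indicator {0..<1} t \<partial>lborel)"
    using AE_lborel_singleton[of "1::real"]
    by (intro nn_integral_cong_AE) (auto elim!: eventually_mono simp: indicator_def)
  finally show ?thesis .
qed

lemma nn_integral_circle_rotate:
  assumes [measurable]: "g \<in> borel_measurable borel" and c: "cmod c = 1"
  shows "(\<integral>\<^sup>+t. g (cis (2 * pi * t) * c) \<partial>circle_measure) = (\<integral>\<^sup>+t. g (cis (2 * pi * t)) \<partial>circle_measure)"
proof -
  define x where "x = Arg2pi c / (2 * pi)"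
  have x: "0 \<le> x" "x < 1" and cx: "c = cis (2 * pi * x)"
    using c Arg2pi[of c] by (auto simp: x_def cis_conv_exp is_Arg_def mult.commute)
  define f where "f = (\<lambda>t::real. g (cis (2 * pi * t)))"
  have [measurable]: "f \<in> borel_measurable borel" unfolding f_def by measurable
  have per: "f (t + 1) = f t" for t
  proof -
    have "cis (2 * pi * (t + 1)) = cis (2 * pi * t) * cis (2 * pi)"
      by (simp add: cis_mult algebra_simps)
    then show ?thesis by (simp add: f_def)
  qed
  have "(\<integral>\<^sup>+t. g (cis (2 * pi * t) * c) \<partial>circle_measure) = (\<integral>\<^sup>+t. f (t + x) * indicator {0..<1} t \<partial>lborel)"
    by (subst nn_integral_circle_measure, simp, simp add: f_def cx cis_mult algebra_simps)
  also have "\<dots> = (\<integral>\<^sup>+t. f (t + x) * indicator {x..<1+x} (t + x) \<partial>lborel)"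
    by (intro nn_integral_cong) (auto simp: indicator_def)
  also have "\<dots> = (\<integral>\<^sup>+t. f t * indicator {x..<1+x} t \<partial>lborel)"
    by (rule nn_integral_lborel_translate[of "\<lambda>t. f t * indicator {x..<1+x} t"]) simp
  \<comment> \<open>The shifted period is cut at 1; by periodicity the part beyond 1 moves back to
    the start and completes the interval from 0 to 1.\<close>
  also have "\<dots> = (\<integral>\<^sup>+t. f t * indicator {x..<1} t + f t * indicator {1..<1+x} t \<partial>lborel)"
    using x by (intro nn_integral_cong) (auto simp: indicator_def)
  also have "\<dots> = (\<integral>\<^sup>+t. f t * indicator {x..<1} t \<partial>lborel) + (\<integral>\<^sup>+t. f t * indicator {1..<1+x} t \<partial>lborel)"
    by (rule nn_integral_add) simp_all
  also have "(\<integral>\<^sup>+t. f t * indicator {1..<1+x} t \<partial>lborel) = (\<integral>\<^sup>+t. f (t + 1) * indicator {1..<1+x} (t + 1) \<partial>lborel)"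
    by (rule nn_integral_lborel_translate[of "\<lambda>t. f t * indicator {1..<1+x} t", symmetric]) simp
  also have "\<dots> = (\<integral>\<^sup>+t. f t * indicator {0..<x} t \<partial>lborel)"
    by (intro nn_integral_cong) (auto simp: indicator_def per)
  also have "(\<integral>\<^sup>+t. f t * indicator {x..<1} t \<partial>lborel) + (\<integral>\<^sup>+t. f t * indicator {0..<x} t \<partial>lborel)
     = (\<integral>\<^sup>+t. f t * indicator {x..<1} t + f t * indicator {0..<x} t \<partial>lborel)"
    by (rule nn_integral_add[symmetric]) simp_all
  also have "\<dots> = (\<integral>\<^sup>+t. f t * indicator {0..<1} t \<partial>lborel)"
    using x by (intro nn_integral_cong) (auto simp: indicator_def)
  also have "\<dots> = (\<integral>\<^sup>+t. g (cis (2 * pi * t)) \<partial>circle_measure)"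
    by (subst nn_integral_circle_measure) (simp_all add: f_def)
  finally show ?thesis .
qed

text \<open>Schwarz's lemma for \<Psi> followed by the disc automorphism that sends \<Psi> 0 to 0.
  The bound is arranged as a fixed multiple of 1 - |z|^2, the variable in which the measure is
  simple.\<close>

lemma Schwarz_Pick_origin:
  assumes \<Psi>: "\<Psi> holomorphic_on \<D>" "\<Psi> \<in> \<D> \<rightarrow> \<D>" and z: "z \<in> \<D>"
  shows "(1 - cmod (\<Psi> 0)) / (1 + cmod (\<Psi> 0)) * (1 - (cmod z)\<^sup>2) \<le> 1 - (cmod (\<Psi> z))\<^sup>2"
proof -
  define a p where "a = \<Psi> 0" and "p = \<Psi> z"
  have a: "cmod a < 1" and p: "cmod p < 1"
    using \<Psi>(2) z by (auto simp: a_def p_def Pi_iff)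
  define \<omega> where "\<omega> = Moebius_function 0 a \<circ> \<Psi>"
  have sub: "\<Psi> ` \<D> \<subseteq> \<D>" using \<Psi>(2) by auto
  have "\<omega> holomorphic_on \<D>"
    unfolding \<omega>_def using a Moebius_function_holomorphic sub
    by (intro holomorphic_on_compose_gen[OF \<Psi>(1)]) auto
  moreover have "cmod (\<omega> u) < 1" if "cmod u < 1" for u
    using that a \<Psi>(2) by (auto simp: \<omega>_def Pi_iff intro!: Moebius_function_norm_lt_1)
  moreover have "\<omega> 0 = 0"
    by (simp add: \<omega>_def a_def Moebius_function_eq_zero)
  ultimately have "cmod (\<omega> z) \<le> cmod z"
    using Schwarz_Lemma(1)[of \<omega> z] z by simp
  then have *: "(cmod (\<omega> z))\<^sup>2 \<le> (cmod z)\<^sup>2" by (simp add: power_mono)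
  \<comment> \<open>B / A is the squared modulus of the automorphism at p, and \<open>AB\<close> is
    the standard identity for 1 minus it. Bounding A below by (1 - |a|)^2 cancels one factor 1 - |a|
    at the end.\<close>
  define A B where "A = (cmod (1 - cnj a * p))\<^sup>2" and "B = (cmod (p - a))\<^sup>2"
  have AB: "A - B = (1 - (cmod a)\<^sup>2) * (1 - (cmod p)\<^sup>2)"
    unfolding A_def B_def by (simp add: cmod_power2, simp add: power2_eq_square algebra_simps)
  have "cmod (cnj a * p) \<le> cmod a"
    using p mult_left_le[of "cmod p" "cmod a"] by (simp add: norm_mult)
  then have "1 - cmod a \<le> cmod (1 - cnj a * p)"
    using norm_triangle_ineq2[of 1 "cnj a * p"] by simp
  then have A: "(1 - cmod a)\<^sup>2 \<le> A"
    unfolding A_def using a by (intro power_mono) auto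
  have A0: "0 < A" using A a by (smt (verit) zero_less_power2)
  have om: "(cmod (\<omega> z))\<^sup>2 = B / A"
    by (simp add: \<omega>_def Moebius_function_simple A_def B_def p_def norm_divide power_divide)
  have "(1 - cmod a)\<^sup>2 * (1 - (cmod z)\<^sup>2) \<le> A * (1 - (cmod z)\<^sup>2)"
    using A z by (intro mult_right_mono) (auto simp: power_le_one)
  also have "\<dots> \<le> A * (1 - B / A)"
    using * om A0 by (intro mult_left_mono) auto
  also have "\<dots> = A - B" using A0 by (simp add: field_simps)
  also have "\<dots> = (1 - cmod a) * ((1 + cmod a) * (1 - (cmod p)\<^sup>2))"
    unfolding AB by (simp add: power2_eq_square algebra_simps)
  finally have "(1 - cmod a) * ((1 - cmod a) * (1 - (cmod z)\<^sup>2))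
      \<le> (1 - cmod a) * ((1 + cmod a) * (1 - (cmod p)\<^sup>2))"
    by (simp add: power2_eq_square mult_ac)
  then have "(1 - cmod a) * (1 - (cmod z)\<^sup>2) \<le> (1 + cmod a) * (1 - (cmod p)\<^sup>2)"
    using a by simp
  then have "(1 - cmod a) * (1 - (cmod z)\<^sup>2) / (1 + cmod a) \<le> 1 - (cmod p)\<^sup>2"
    by (subst pos_divide_le_eq) (auto simp: mult.commute add_pos_nonneg)
  then show ?thesis by (simp add: a_def p_def)
qed

text \<open>Expanding the fraction by the sum of the moduli, at most 2, gives the 4. Squares appear
  because R^2, rather than R, is explicit in the application.\<close>

lemma poisson_le_square:
  assumes "cmod w < cmod \<zeta>" "cmod \<zeta> \<le> 1"
  shows "poisson w \<zeta> \<le> 4 / ((cmod \<zeta>)\<^sup>2 - (cmod w)\<^sup>2)"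
proof -
  let ?x = "cmod \<zeta>" and ?y = "cmod w"
  have "poisson w \<zeta> \<le> (?x + ?y) / (?x - ?y)" by (rule poisson_le) fact
  also have "\<dots> = (?x + ?y)\<^sup>2 / (?x\<^sup>2 - ?y\<^sup>2)"
  proof -
    have "?x\<^sup>2 - ?y\<^sup>2 = (?x + ?y) * (?x - ?y)" by (simp add: power2_eq_square algebra_simps)
    moreover have "?x + ?y \<noteq> 0" using assms norm_ge_zero[of w] by linarith
    ultimately show ?thesis by (simp add: power2_eq_square)
  qed
  also have "\<dots> \<le> 4 / (?x\<^sup>2 - ?y\<^sup>2)"
  proof (rule divide_right_mono)
    have "(?x + ?y)\<^sup>2 \<le> 2\<^sup>2" using assms by (intro power_mono) auto
    then show "(?x + ?y)\<^sup>2 \<le> 4" by simp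
    show "0 \<le> ?x\<^sup>2 - ?y\<^sup>2" using assms by (simp add: power_mono)
  qed
  finally show ?thesis .
qed

text \<open>Subordination: |h| at a point of the image is at most a Poisson average of |h| over the
  circle of radius R. Averaging over the rotations of z and exchanging integrals leaves the Poisson
  kernel at \<Psi> 0 alone, which is bounded along that circle.\<close>

lemma circle_average_composition_le:
  assumes h: "h holomorphic_on \<D>" and [measurable]: "h \<in> borel_measurable borel"
    and \<Psi>: "\<Psi> holomorphic_on \<D>" and [measurable]: "\<Psi> \<in> borel_measurable borel"
    and z: "z \<in> \<D>" and R: "R < 1" and \<Psi>R: "\<And>u. cmod u \<le> cmod z \<Longrightarrow> cmod (\<Psi> u) < R"
  shows "(\<integral>\<^sup>+t. ennreal (cmod (h (\<Psi> (cis (2 * pi * t) * z)))) \<partial>circle_measure)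
    \<le> ennreal (4 / (R\<^sup>2 - (cmod (\<Psi> 0))\<^sup>2)) *
        (\<integral>\<^sup>+s. ennreal (cmod (h (R * cis (2 * pi * s)))) \<partial>circle_measure)"
proof -
  interpret C: prob_space circle_measure by (rule prob_space_circle_measure)
  interpret pair_sigma_finite circle_measure circle_measure ..
  have R0: "0 < R" using \<Psi>R[of 0] by (rule le_less_trans[OF norm_ge_zero]) simp
  define \<zeta> where "\<zeta> = (\<lambda>s. complex_of_real R * cis (2 * pi * s))"
  have [measurable]: "\<zeta> \<in> borel_measurable borel" unfolding \<zeta>_def by measurable
  have n\<zeta>: "cmod (\<zeta> s) = R" for s using R0 by (simp add: \<zeta>_def norm_mult)
  have c\<zeta>: "continuous_on S \<zeta>" for S unfolding \<zeta>_def by (intro continuous_intros)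
  have [measurable]: "(\<lambda>x. poisson (f x) (g x)) \<in> borel_measurable N"
    if [measurable]: "f \<in> borel_measurable N" "g \<in> borel_measurable N" for f g :: "'c \<Rightarrow> complex" and N
    unfolding poisson_def by measurable
  have hR: "h holomorphic_on cball 0 R"
    using h by (rule holomorphic_on_subset) (use R in auto)
  define w where "w = (\<lambda>t. \<Psi> (cis (2 * pi * t) * z))"
  have [measurable]: "w \<in> borel_measurable borel" unfolding w_def by measurable
  have wR: "cmod (w t) < R" for t by (simp add: w_def \<Psi>R norm_mult)
  have P0: "poisson (w t) (\<zeta> s) \<ge> 0" for s t
    using wR[of t] by (intro poisson_nonneg) (simp add: n\<zeta>)
  have *: "ennreal (cmod (h (w t))) \<le> (\<integral>\<^sup>+s. ennreal (cmod (h (\<zeta> s))) * ennreal (poisson (w t) (\<zeta> s)) \<partial>circle_measure)"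
    for t
  proof -
    have hi: "((\<lambda>s. h (\<zeta> s) * of_real (poisson (w t) (\<zeta> s))) has_integral h (w t)) {0..1}"
      unfolding \<zeta>_def by (rule poisson_formula[OF hR wR])
    have ne: "\<zeta> s \<noteq> w t" for s using wR[of t] n\<zeta>[of s] by auto
    have "continuous_on {0..1} (\<lambda>s. h (\<zeta> s))"
      by (rule continuous_on_compose2[OF holomorphic_on_imp_continuous_on[OF hR] c\<zeta>])
        (auto simp: n\<zeta>)
    then have cont: "continuous_on {0..1} (\<lambda>s. h (\<zeta> s) * of_real (poisson (w t) (\<zeta> s)))"
      unfolding poisson_def using ne by (intro continuous_intros c\<zeta>) auto
    have "ennreal (norm (LINT s|circle_measure. h (\<zeta> s) * of_real (poisson (w t) (\<zeta> s))))
       \<le> (\<integral>\<^sup>+s. norm (h (\<zeta> s) * of_real (poisson (w t) (\<zeta> s))) \<partial>circle_measure)"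
      by (rule integral_norm_bound_ennreal) (rule circle_measure_has_integral(1)[OF _ cont hi], measurable)
    also have "(LINT s|circle_measure. h (\<zeta> s) * of_real (poisson (w t) (\<zeta> s))) = h (w t)"
      by (rule circle_measure_has_integral(2)[OF _ cont hi]) measurable
    finally show ?thesis using P0 by (simp add: norm_mult ennreal_mult)
  qed
  \<comment> \<open>For fixed \<zeta> s the Poisson kernel along \<Psi> (u z) is the real part of
    the holomorphic function G of u, so its average over |u| = 1 is its value at the centre.\<close>
  have mean: "(\<integral>\<^sup>+t. ennreal (poisson (w t) (\<zeta> s)) \<partial>circle_measure) = ennreal (poisson (\<Psi> 0) (\<zeta> s))" for s
  proof -
    define G where "G = (\<lambda>u. (\<zeta> s + \<Psi> (u * z)) / (\<zeta> s - \<Psi> (u * z)))"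
    have uz: "cmod (u * z) \<le> cmod z" if "cmod u \<le> 1" for u
      using that by (simp add: norm_mult mult_left_le_one_le)
    have ne: "\<zeta> s - \<Psi> (u * z) \<noteq> 0" if "cmod u \<le> 1" for u
      using \<Psi>R[OF uz[OF that]] n\<zeta>[of s] by auto
    have "(\<lambda>u. \<Psi> (u * z)) holomorphic_on cball 0 1"
      by (rule holomorphic_on_compose_gen[OF _ \<Psi>, unfolded o_def])
        (use uz z in \<open>force intro!: holomorphic_intros\<close>)+
    then have G: "G holomorphic_on cball 0 1"
      unfolding G_def by (intro holomorphic_intros) (use ne in auto)
    have "((\<lambda>t. Re (G (cis (2 * pi * t)))) has_integral Re (G 0)) {0..1}"
      using has_integral_linear[OF disc_mean_value[OF G] bounded_linear_Re] by (simp add: o_def)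
    moreover have "G (cis (2 * pi * t)) = (\<zeta> s + w t) / (\<zeta> s - w t)" for t
      by (simp add: G_def w_def)
    moreover have "G 0 = (\<zeta> s + \<Psi> 0) / (\<zeta> s - \<Psi> 0)" by (simp add: G_def)
    ultimately have hi: "((\<lambda>t. poisson (w t) (\<zeta> s)) has_integral poisson (\<Psi> 0) (\<zeta> s)) {0..1}"
      by (simp add: poisson_eq_Re)
    have "continuous_on {0..1} (\<lambda>t. Re (G (cis (2 * pi * t))))"
      by (intro continuous_intros continuous_on_compose2[OF holomorphic_on_imp_continuous_on[OF G]]) auto
    then have cont: "continuous_on {0..1} (\<lambda>t. poisson (w t) (\<zeta> s))"
      by (simp add: poisson_eq_Re G_def w_def)
    have m: "(\<lambda>t. poisson (w t) (\<zeta> s)) \<in> borel_measurable borel" by measurable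
    show ?thesis
      using circle_measure_has_integral[OF m cont hi] P0
      by (subst nn_integral_eq_integral) auto
  qed
  have "(\<integral>\<^sup>+t. ennreal (cmod (h (w t))) \<partial>circle_measure)
     \<le> (\<integral>\<^sup>+t. \<integral>\<^sup>+s. ennreal (cmod (h (\<zeta> s))) * ennreal (poisson (w t) (\<zeta> s)) \<partial>circle_measure \<partial>circle_measure)"
    by (intro nn_integral_mono *)
  also have "\<dots> = (\<integral>\<^sup>+s. \<integral>\<^sup>+t. ennreal (cmod (h (\<zeta> s))) * ennreal (poisson (w t) (\<zeta> s)) \<partial>circle_measure \<partial>circle_measure)"
    by (rule Fubini'[symmetric]) measurable
  also have "\<dots> = (\<integral>\<^sup>+s. ennreal (cmod (h (\<zeta> s))) * ennreal (poisson (\<Psi> 0) (\<zeta> s)) \<partial>circle_measure)"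
    by (simp add: nn_integral_cmult mean)
  also have "\<dots> \<le> (\<integral>\<^sup>+s. ennreal (4 / (R\<^sup>2 - (cmod (\<Psi> 0))\<^sup>2)) * ennreal (cmod (h (\<zeta> s))) \<partial>circle_measure)"
  proof (intro nn_integral_mono)
    fix s
    have "poisson (\<Psi> 0) (\<zeta> s) \<le> 4 / (R\<^sup>2 - (cmod (\<Psi> 0))\<^sup>2)"
      using poisson_le_square[of "\<Psi> 0" "\<zeta> s"] \<Psi>R[of 0] R by (simp add: n\<zeta>)
    then show "ennreal (cmod (h (\<zeta> s))) * ennreal (poisson (\<Psi> 0) (\<zeta> s))
        \<le> ennreal (4 / (R\<^sup>2 - (cmod (\<Psi> 0))\<^sup>2)) * ennreal (cmod (h (\<zeta> s)))"
      by (subst mult.commute) (intro mult_right_mono ennreal_leI, auto)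
  qed
  also have "\<dots> = ennreal (4 / (R\<^sup>2 - (cmod (\<Psi> 0))\<^sup>2)) * (\<integral>\<^sup>+s. ennreal (cmod (h (\<zeta> s))) \<partial>circle_measure)"
    by (rule nn_integral_cmult) measurable
  finally show ?thesis by (simp add: w_def \<zeta>_def)
qed

lemma borel_measurable_disc_extension:
  fixes f :: "complex \<Rightarrow> complex"
  assumes "f holomorphic_on \<D>"
  shows "(\<lambda>z. if z \<in> \<D> then f z else 0) \<in> borel_measurable borel"
  by (rule borel_measurable_continuous_on_if)
    (auto intro: holomorphic_on_imp_continuous_on[OF assms])

text \<open>Substituting \<kappa> s for s in the radial integral: the Jacobian and the weight
  contribute \<kappa>^(\<alpha> + 1). Only an inequality results because the scaled variable stays
  in (0, \<kappa>], a part of (0, 1].\<close>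

lemma nn_integral_dilate_le:
  assumes \<kappa>: "0 < \<kappa>" "\<kappa> \<le> 1" and [measurable]: "m \<in> borel_measurable borel"
  shows "ennreal (\<kappa> powr (\<alpha> + 1)) * (\<integral>\<^sup>+z. m (\<kappa> * (1 - (cmod z)\<^sup>2)) \<partial>bergman_measure \<alpha>)
    \<le> (\<integral>\<^sup>+z. m (1 - (cmod z)\<^sup>2) \<partial>bergman_measure \<alpha>)"
proof -
  have "ennreal (\<kappa> powr (\<alpha> + 1)) * (\<integral>\<^sup>+z. m (\<kappa> * (1 - (cmod z)\<^sup>2)) \<partial>bergman_measure \<alpha>)
    = ennreal (\<kappa> powr (\<alpha> + 1)) * (\<integral>\<^sup>+s. ennreal ((\<alpha> + 1) * s powr \<alpha>) * m (\<kappa> * s) * indicator {0<..1} s \<partial>lborel)"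
    by (subst nn_integral_bergman_radial[of "\<lambda>s. m (\<kappa> * s)"]) simp_all
  also have "\<dots> = (\<integral>\<^sup>+s. ennreal (\<kappa> powr (\<alpha> + 1)) * (ennreal ((\<alpha> + 1) * s powr \<alpha>) * m (\<kappa> * s) * indicator {0<..1} s) \<partial>lborel)"
    by (rule nn_integral_cmult[symmetric]) measurable
  also have "\<dots> \<le> (\<integral>\<^sup>+s. ennreal \<kappa> * (ennreal ((\<alpha> + 1) * (\<kappa> * s) powr \<alpha>) * m (\<kappa> * s) * indicator {0<..1} (\<kappa> * s)) \<partial>lborel)"
  proof (rule nn_integral_mono)
    fix s :: real
    show "ennreal (\<kappa> powr (\<alpha> + 1)) * (ennreal ((\<alpha> + 1) * s powr \<alpha>) * m (\<kappa> * s) * indicator {0<..1} s)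
       \<le> ennreal \<kappa> * (ennreal ((\<alpha> + 1) * (\<kappa> * s) powr \<alpha>) * m (\<kappa> * s) * indicator {0<..1} (\<kappa> * s))"
    proof (cases "s \<in> {0<..1}")
      case True
      then have "\<kappa> * s \<in> {0<..1}" using \<kappa> by (auto simp: mult_le_one)
      moreover have "ennreal (\<kappa> powr (\<alpha> + 1)) * ennreal ((\<alpha> + 1) * s powr \<alpha>) = ennreal \<kappa> * ennreal ((\<alpha> + 1) * (\<kappa> * s) powr \<alpha>)"
        using True \<kappa> by (simp add: ennreal_mult'[symmetric] powr_mult powr_add mult_ac)
      ultimately show ?thesis using True by (simp add: mult.assoc[symmetric])
    qed simp
  qed
  also have "\<dots> = ennreal \<kappa> * (\<integral>\<^sup>+s. (ennreal ((\<alpha> + 1) * (\<kappa> * s) powr \<alpha>) * m (\<kappa> * s) * indicator {0<..1} (\<kappa> * s)) \<partial>lborel)"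
    by (rule nn_integral_cmult) measurable
  also have "\<dots> = (\<integral>\<^sup>+s. (ennreal ((\<alpha> + 1) * s powr \<alpha>) * m s * indicator {0<..1} s) \<partial>lborel)"
    using \<kappa> by (subst nn_integral_real_affine[where c = \<kappa> and t = 0]) auto
  also have "\<dots> = (\<integral>\<^sup>+z. m (1 - (cmod z)\<^sup>2) \<partial>bergman_measure \<alpha>)"
    by (rule nn_integral_bergman_radial[symmetric]) simp
  finally show ?thesis .
qed

lemma integrable_comp_op:
  assumes \<alpha>: "\<alpha> > -1" and h: "h holomorphic_on \<D>" and hi: "integrable (bergman_measure \<alpha>) h"
    and \<Psi>: "\<Psi> holomorphic_on \<D>" "\<Psi> \<in> \<D> \<rightarrow> \<D>"
  shows "integrable (bergman_measure \<alpha>) (comp_op \<Psi> h)"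
proof -
  interpret C: prob_space circle_measure by (rule prob_space_circle_measure)
  have hm [measurable]: "h \<in> borel_measurable borel" using hi by auto
  \<comment> \<open>Nothing is known of \<Psi> outside the disc; its extension by 0 is Borel on the
    whole plane.\<close>
  define \<psi> where "\<psi> = (\<lambda>z. if z \<in> \<D> then \<Psi> z else 0)"
  have \<psi>m [measurable]: "\<psi> \<in> borel_measurable borel"
    unfolding \<psi>_def by (rule borel_measurable_disc_extension) fact
  have \<psi>h: "\<psi> holomorphic_on \<D>"
    using \<Psi>(1) by (rule holomorphic_transform) (simp add: \<psi>_def)
  have \<psi>D: "\<psi> \<in> \<D> \<rightarrow> \<D>" using \<Psi>(2) by (auto simp: \<psi>_def Pi_iff)
  define A where "A = cmod (\<psi> 0)"
  \<comment> \<open>Half of the Schwarz-Pick constant: the half given away keeps the values of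
    \<psi> strictly inside the circle of radius R, as the Poisson formula demands. Moreover R^2 -
    A^2 stays above 1 - \<kappa> - A^2 > 0, so C does not depend on z.\<close>
  define \<kappa> where "\<kappa> = (1 - A) / (1 + A) / 2"
  have A: "0 \<le> A" "A < 1" using \<psi>D by (auto simp: A_def Pi_iff)
  then have \<kappa>: "0 < \<kappa>" "\<kappa> \<le> 1" by (auto simp: \<kappa>_def field_simps)
  have \<kappa>A: "0 < 1 - \<kappa> - A\<^sup>2"
  proof -
    have "(1 - A) / (1 + A) \<le> 1 - A" using A mult_left_le[of A A] by (simp add: field_simps)
    moreover have "A\<^sup>2 \<le> A" using A by (simp add: power2_eq_square mult_left_le)
    moreover have "0 < 1 - x / 2 - y" if "x \<le> 1 - A" "y \<le> A" for x y
      using that A by (simp add: field_simps)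
    ultimately show ?thesis unfolding \<kappa>_def by blast
  qed
  define C where "C = 4 / (1 - \<kappa> - A\<^sup>2)"
  \<comment> \<open>Mean of |h| over a circle, indexed by 1 minus the squared radius, so that
    passing from |z| to R is multiplication of the index by \<kappa>.\<close>
  define m where "m = (\<lambda>x. \<integral>\<^sup>+s. ennreal (cmod (h (sqrt (1 - x) * cis (2 * pi * s)))) \<partial>circle_measure)"
  have [measurable]: "m \<in> borel_measurable borel"
    unfolding m_def by measurable
  have avg: "(\<integral>\<^sup>+t. ennreal (cmod (h (\<psi> (cis (2 * pi * t) * z)))) \<partial>circle_measure)
     \<le> ennreal C * m (\<kappa> * (1 - (cmod z)\<^sup>2))" if z: "z \<in> \<D>" for z
  proof -
    have z1: "(cmod z)\<^sup>2 < 1" using z by (simp add: power_less_one_iff)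
    define R where "R = sqrt (1 - \<kappa> * (1 - (cmod z)\<^sup>2))"
    have pos: "0 < \<kappa> * (1 - (cmod z)\<^sup>2)" using \<kappa> z1 by simp
    have le: "\<kappa> * (1 - (cmod z)\<^sup>2) \<le> \<kappa>"
      using \<kappa> z1 by (intro mult_left_le) auto
    have R2: "R\<^sup>2 = 1 - \<kappa> * (1 - (cmod z)\<^sup>2)"
      using order_trans[OF le \<kappa>(2)] by (simp add: R_def)
    have R1: "R < 1" unfolding R_def using pos by simp
    have \<psi>R: "cmod (\<psi> u) < R" if u: "cmod u \<le> cmod z" for u
    proof -
      have "2 * \<kappa> * (1 - (cmod u)\<^sup>2) \<le> 1 - (cmod (\<psi> u))\<^sup>2"
      proof -
        have "2 * \<kappa> = (1 - cmod (\<psi> 0)) / (1 + cmod (\<psi> 0))" 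
        proof -
          have "2 * (c / 2) = c" for c :: real by simp
          then show ?thesis unfolding \<kappa>_def A_def .
        qed
        moreover have "u \<in> \<D>" using u z by simp
        ultimately show ?thesis using Schwarz_Pick_origin[OF \<psi>h \<psi>D] by (simp only:)
      qed
      moreover have "2 * \<kappa> * (1 - (cmod z)\<^sup>2) \<le> 2 * \<kappa> * (1 - (cmod u)\<^sup>2)"
        using \<kappa> u by (intro mult_left_mono) (auto intro: power_mono)
      ultimately have "(cmod (\<psi> u))\<^sup>2 < 1 - \<kappa> * (1 - (cmod z)\<^sup>2)"
        using pos by linarith
      then show ?thesis unfolding R_def by (rule real_less_rsqrt)
    qed
    have "(\<integral>\<^sup>+t. ennreal (cmod (h (\<psi> (cis (2 * pi * t) * z)))) \<partial>circle_measure)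
      \<le> ennreal (4 / (R\<^sup>2 - A\<^sup>2)) * m (\<kappa> * (1 - (cmod z)\<^sup>2))"
      unfolding A_def m_def R_def[symmetric]
      by (rule circle_average_composition_le[OF h hm \<psi>h \<psi>m z R1 \<psi>R])
    also have "\<dots> \<le> ennreal C * m (\<kappa> * (1 - (cmod z)\<^sup>2))"
      unfolding C_def using \<kappa>A le R2
      by (intro mult_right_mono ennreal_leI divide_left_mono) auto
    finally show ?thesis .
  qed
  \<comment> \<open>The circle through z may be started at its positive real point, so its mean
    depends on |z| alone.\<close>
  have rot: "(\<integral>\<^sup>+t. ennreal (cmod (h (cis (2 * pi * t) * z))) \<partial>circle_measure) = m (1 - (cmod z)\<^sup>2)" for z
  proof (cases "z = 0")
    case False
    have "(\<integral>\<^sup>+t. ennreal (cmod (h (cmod z * (cis (2 * pi * t) * sgn z)))) \<partial>circle_measure)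
       = (\<integral>\<^sup>+t. ennreal (cmod (h (cmod z * cis (2 * pi * t)))) \<partial>circle_measure)"
      by (rule nn_integral_circle_rotate[of "\<lambda>u. ennreal (cmod (h (cmod z * u)))"])
        (use False in \<open>simp_all add: norm_sgn\<close>)
    moreover have "cmod z * (cis (2 * pi * t) * sgn z) = cis (2 * pi * t) * z" for t
      using False by (simp add: sgn_eq)
    ultimately show ?thesis by (simp add: m_def)
  qed (simp add: m_def)
  have "(\<integral>\<^sup>+z. ennreal (cmod (h (\<psi> z))) \<partial>bergman_measure \<alpha>)
     = (\<integral>\<^sup>+z. \<integral>\<^sup>+t. ennreal (cmod (h (\<psi> (cis (2 * pi * t) * z)))) \<partial>circle_measure \<partial>bergman_measure \<alpha>)"
    by (rule nn_integral_bergman_average[OF \<alpha>]) measurable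
  also have "\<dots> \<le> (\<integral>\<^sup>+z. ennreal C * m (\<kappa> * (1 - (cmod z)\<^sup>2)) \<partial>bergman_measure \<alpha>)"
    using AE_bergman_disc[of \<alpha>] by (intro nn_integral_mono_AE) (auto elim!: eventually_mono intro: avg)
  also have "\<dots> = ennreal C * (\<integral>\<^sup>+z. m (\<kappa> * (1 - (cmod z)\<^sup>2)) \<partial>bergman_measure \<alpha>)"
    by (rule nn_integral_cmult) measurable
  also have "\<dots> < \<infinity>"
  proof -
    have "ennreal (\<kappa> powr (\<alpha> + 1)) * (\<integral>\<^sup>+z. m (\<kappa> * (1 - (cmod z)\<^sup>2)) \<partial>bergman_measure \<alpha>)
       \<le> (\<integral>\<^sup>+z. m (1 - (cmod z)\<^sup>2) \<partial>bergman_measure \<alpha>)"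
      by (rule nn_integral_dilate_le) (use \<kappa> in auto)
    also have "\<dots> = (\<integral>\<^sup>+z. ennreal (cmod (h z)) \<partial>bergman_measure \<alpha>)"
      unfolding rot[symmetric]
      by (rule nn_integral_bergman_average[OF \<alpha>, of "\<lambda>z. ennreal (cmod (h z))", symmetric]) measurable
    also have "\<dots> < \<infinity>" using hi by (simp add: integrable_iff_bounded)
    finally have "ennreal (\<kappa> powr (\<alpha> + 1)) * (\<integral>\<^sup>+z. m (\<kappa> * (1 - (cmod z)\<^sup>2)) \<partial>bergman_measure \<alpha>) < \<infinity>" .
    then show ?thesis using \<kappa> by (auto simp: ennreal_mult_less_top)
  qed
  finally have "integrable (bergman_measure \<alpha>) (\<lambda>z. h (\<psi> z))"
    by (intro integrableI_bounded) simp_all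
  then show ?thesis
  proof (rule integrable_cong_AE_imp)
    show "comp_op \<Psi> h \<in> borel_measurable (bergman_measure \<alpha>)"
    proof -
      have "comp_op \<Psi> h = (\<lambda>z. if z \<in> \<D> then h (\<psi> z) else 0)"
        by (auto simp: comp_op_def \<psi>_def)
      moreover have "\<D> \<in> sets borel" by simp
      ultimately show ?thesis by simp
    qed
    show "AE x in bergman_measure \<alpha>. h (\<psi> x) = comp_op \<Psi> h x"
      using AE_bergman_disc by eventually_elim (simp add: comp_op_def \<psi>_def)
  qed
qed

section \<open>Moments and the reproducing kernel\<close>

lemma measurable_cnj [measurable]: "cnj \<in> borel_measurable borel"
  by (intro borel_measurable_continuous_onI continuous_intros)

locale bergman_weight =
  fixes \<alpha> :: real
  assumes alpha: "\<alpha> > -1"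
begin

abbreviation "M \<equiv> bergman_measure \<alpha>"

sublocale prob_space M
  by (rule prob_space_bergman[OF alpha])

lemma bounded_integrable:
  fixes f :: "complex \<Rightarrow> 'a :: {banach, second_countable_topology}"
  assumes "f \<in> borel_measurable borel" "\<And>z. z \<in> \<D> \<Longrightarrow> norm (f z) \<le> B"
  shows "integrable M f"
  by (rule integrable_const_bound[where B = B])
    (use assms AE_bergman_disc[of \<alpha>] in \<open>auto elim!: eventually_mono\<close>)

lemma bounded_mult_integrable:
  fixes f g :: "complex \<Rightarrow> complex"
  assumes f: "integrable M f" and [measurable]: "g \<in> borel_measurable borel"
    and B: "\<And>z. z \<in> \<D> \<Longrightarrow> cmod (g z) \<le> B"
  shows "integrable M (\<lambda>z. f z * g z)"
proof (rule Bochner_Integration.integrable_bound[where f = "\<lambda>z. B * cmod (f z)"])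
  have [measurable]: "f \<in> borel_measurable borel" using f by auto
  show "integrable M (\<lambda>z. B * cmod (f z))" using f by simp
  show "(\<lambda>z. f z * g z) \<in> borel_measurable M" by measurable
  show "AE z in M. norm (f z * g z) \<le> norm (B * cmod (f z))"
    using AE_bergman_disc
  proof eventually_elim
    fix z assume "z \<in> \<D>"
    then have "cmod (g z) \<le> \<bar>B\<bar>" using B[of z] by simp
    then show "norm (f z * g z) \<le> norm (B * cmod (f z))"
      using mult_left_mono[of "cmod (g z)" "\<bar>B\<bar>" "cmod (f z)"]
      by (simp add: norm_mult abs_mult mult.commute)
  qed
qed

lemma integral_cong_disc:
  assumes "\<And>z. z \<in> \<D> \<Longrightarrow> f z = g z" "f \<in> borel_measurable borel" "g \<in> borel_measurable borel"
  shows "(LINT z|M. f z) = (LINT z|M. g z)"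
  by (rule integral_cong_AE) (use assms AE_bergman_disc[of \<alpha>] in \<open>auto elim!: eventually_mono\<close>)

text \<open>By continuity the points with u nonzero form an open set; a nonempty one would
  contradict u = 0 almost everywhere.\<close>

lemma integral_eq_0_imp_zero:
  fixes u :: "complex \<Rightarrow> real"
  assumes u: "integrable M u" "(LINT z|M. u z) = 0" and cont: "continuous_on \<D> u"
    and pos: "\<And>z. z \<in> \<D> \<Longrightarrow> u z \<ge> 0" and z: "z \<in> \<D>"
  shows "u z = 0"
proof (rule ccontr)
  assume ne: "u z \<noteq> 0"
  have "AE z in M. 0 \<le> u z"
    using AE_bergman_disc by eventually_elim (rule pos)
  then have "AE z in M. u z = 0"
    using integral_nonneg_eq_0_iff_AE u by blast
  moreover have "open {z \<in> \<D>. u z \<noteq> 0}"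
  proof -
    have "open (u -` (- {0}) \<inter> \<D>)"
      using cont by (intro continuous_on_open_vimage[THEN iffD1, rule_format]) auto
    moreover have "u -` (- {0}) \<inter> \<D> = {z \<in> \<D>. u z \<noteq> 0}" by auto
    ultimately show ?thesis by simp
  qed
  ultimately have "\<exists>w\<in>{z \<in> \<D>. u z \<noteq> 0}. u w = 0"
    by (rule AE_bergman_open[OF alpha]) (use ne z in auto)
  then show False by auto
qed

text \<open>The squared norm of the n-th monomial; its reciprocal is the n-th coefficient of (1 -
  x)^(-(\<alpha> + 2)).\<close>

definition moment :: "nat \<Rightarrow> real"
  where "moment n = (LINT z|M. cmod z ^ (2 * n))"

lemma moment_integrable: "integrable M (\<lambda>z. cmod z ^ n)"
  by (rule bounded_integrable[where B = 1]) (auto simp: power_le_one norm_power)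

lemma moment_0 [simp]: "moment 0 = 1"
  by (simp add: moment_def prob_space[simplified])

text \<open>The annulus s < |z| < 1 has positive mass p, and the integrand is at least s^(2n) there.
  As p is independent of n, the moments decay more slowly than any geometric sequence.\<close>

lemma moment_lower:
  assumes "0 \<le> s" "s < 1"
  obtains p where "p > 0" "\<And>n. p * s ^ (2 * n) \<le> moment n"
proof -
  define U where "U = \<D> - cball 0 s"
  have U: "open U" unfolding U_def by (intro open_Diff) auto
  have [measurable]: "U \<in> sets borel" using U by simp
  have "measure M U > 0"
  proof (rule ccontr)
    assume "\<not> measure M U > 0"
    then have "measure M U = 0" using measure_nonneg[of M U] by linarith
    then have ae: "AE z in M. z \<notin> U"
      using U by (intro AE_not_in) (auto simp: null_sets_def emeasure_eq_measure)
    obtain q where "s < q" "q < 1" using dense[OF assms(2)] by blast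
    then have "complex_of_real q \<in> U"
      using assms by (simp add: U_def)
    then have "U \<noteq> {}" by blast
    moreover have "U \<subseteq> \<D>" by (auto simp: U_def)
    ultimately show False
      using AE_bergman_open[OF alpha ae U] by blast
  qed
  moreover have "measure M U * s ^ (2 * n) \<le> moment n" for n
  proof -
    have "measure M U * s ^ (2 * n) = (LINT z|M. indicator U z * s ^ (2 * n))"
      by simp
    also have "\<dots> \<le> moment n"
      unfolding moment_def
    proof (rule integral_mono)
      show "integrable M (\<lambda>z. indicator U z * s ^ (2 * n))"
        by (rule bounded_integrable[where B = 1])
          (use assms in \<open>auto simp: indicator_def power_le_one abs_mult\<close>)
      show "integrable M (\<lambda>z. cmod z ^ (2 * n))" by (rule moment_integrable)
      fix z show "indicator U z * s ^ (2 * n) \<le> cmod z ^ (2 * n)"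
        using assms by (auto simp: U_def indicator_def intro!: power_mono)
    qed
    finally show ?thesis .
  qed
  ultimately show ?thesis using that by blast
qed

lemma moment_pos: "moment n > 0"
proof -
  obtain p where p: "p > 0" "\<And>n. p * (1/2) ^ (2 * n) \<le> moment n"
    by (rule moment_lower[of "1/2"]) auto
  have "0 < p * (1/2) ^ (2 * n)" using p(1) by simp
  also have "\<dots> \<le> moment n" by (rule p(2))
  finally show ?thesis .
qed

lemma moment_nonzero [simp]: "moment n \<noteq> 0"
  using moment_pos[of n] by simp

lemma kernel_summable:
  assumes "0 \<le> r" "r < 1"
  shows "summable (\<lambda>n. r ^ n / moment n)"
proof -
  \<comment> \<open>Any q strictly between r and 1 gives a geometric majorant of ratio r / q; the
    moment bound is taken at \<open>sqrt q\<close> because its exponent is 2n.\<close>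
  define q where "q = (1 + r) / 2"
  have q: "0 < q" "r < q" "q < 1" using assms by (auto simp: q_def)
  obtain p where p: "p > 0" "\<And>n. p * sqrt q ^ (2 * n) \<le> moment n"
    using moment_lower[of "sqrt q"] q by auto
  have "summable (\<lambda>n. (r / q) ^ n / p)"
    using q assms by (intro summable_divide summable_geometric) auto
  then show ?thesis
  proof (rule summable_comparison_test_ev[rotated], intro always_eventually allI)
    fix n
    have "p * q ^ n \<le> moment n" using p(2)[of n] q by (simp add: power_mult)
    then have "r ^ n / moment n \<le> r ^ n / (p * q ^ n)"
      using assms p(1) q by (intro divide_left_mono) (auto simp: moment_pos)
    then show "norm (r ^ n / moment n) \<le> (r / q) ^ n / p"
      using assms moment_pos[of n] by (simp add: power_divide mult.commute)
  qed
qed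

lemma kernel_norm_summable:
  fixes x :: complex
  assumes "cmod x < 1"
  shows "summable (\<lambda>n. cmod (x ^ n / of_real (moment n)))"
  using kernel_summable[of "cmod x"] assms moment_pos
  by (simp add: norm_divide norm_power less_imp_le)

text \<open>The kernel (1 - cnj w z)^(-(\<alpha> + 2)) as a series, ready for termwise integration,
  and extended by 0 as elements of the space are.\<close>

definition kernel :: "complex \<Rightarrow> complex \<Rightarrow> complex"
  where "kernel w z = (if z \<in> \<D> then (\<Sum>n. (cnj w * z) ^ n / of_real (moment n)) else 0)"

lemma kernel_outside [simp]: "z \<notin> \<D> \<Longrightarrow> kernel w z = 0"
  by (simp add: kernel_def)

lemma cmod_kernel_arg:
  assumes "w \<in> \<D>" "z \<in> \<D>"
  shows "cmod (cnj w * z) \<le> cmod w" "cmod (cnj w * z) < 1"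
proof -
  show *: "cmod (cnj w * z) \<le> cmod w"
    using assms by (simp add: norm_mult mult_left_le)
  show "cmod (cnj w * z) < 1"
    using * assms(1) by simp
qed

lemma kernel_sums:
  assumes "w \<in> \<D>" "z \<in> \<D>"
  shows "(\<lambda>n. (cnj w * z) ^ n / of_real (moment n)) sums kernel w z"
  using summable_sums[OF summable_norm_cancel[OF kernel_norm_summable[OF cmod_kernel_arg(2)[OF assms]]]] assms
  by (simp add: kernel_def)

text \<open>The bound is uniform in z, so the product of an integrable function with a kernel is
  integrable.\<close>

lemma kernel_bound:
  assumes "w \<in> \<D>" "z \<in> \<D>"
  shows "cmod (kernel w z) \<le> (\<Sum>n. cmod w ^ n / moment n)"
proof -
  note s = kernel_norm_summable[OF cmod_kernel_arg(2)[OF assms]]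
  have "cmod (kernel w z) \<le> (\<Sum>n. cmod ((cnj w * z) ^ n / of_real (moment n)))"
    using summable_norm[OF s] assms by (simp add: kernel_def)
  also have "\<dots> \<le> (\<Sum>n. cmod w ^ n / moment n)"
  proof (rule suminf_le[OF _ s])
    show "summable (\<lambda>n. cmod w ^ n / moment n)"
      using assms by (intro kernel_summable) auto
    fix n show "cmod ((cnj w * z) ^ n / of_real (moment n)) \<le> cmod w ^ n / moment n"
      using cmod_kernel_arg(1)[OF assms] moment_pos[of n]
      by (simp add: norm_divide norm_power divide_right_mono power_mono)
  qed
  finally show ?thesis .
qed

lemma kernel_holomorphic:
  assumes "w \<in> \<D>"
  shows "kernel w holomorphic_on \<D>"
proof (rule power_series_holomorphic)
  fix z assume "z \<in> \<D>"
  from kernel_sums[OF assms this]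
  show "(\<lambda>n. cnj w ^ n / of_real (moment n) * (z - 0) ^ n) sums kernel w z"
    by (simp add: power_mult_distrib)
qed

text \<open>The constant 1 is itself a kernel, so pairing with it is evaluation at 0.\<close>

lemma kernel_0: "kernel 0 z = (if z \<in> \<D> then 1 else 0)"
proof (cases "z \<in> \<D>")
  case True
  have "(\<lambda>n. (cnj 0 * z) ^ n / of_real (moment n)) = (\<lambda>n. if n = 0 then 1 else 0)"
    by (auto simp: fun_eq_iff)
  then show ?thesis
    using kernel_sums[of 0 z] True sums_If_finite_set[of "{0::nat}" "\<lambda>_. 1::complex"]
    by (simp add: sums_unique2)
qed simp

lemma extension_measurable:
  fixes f :: "complex \<Rightarrow> complex"
  assumes "f holomorphic_on \<D>" "\<And>z. z \<notin> \<D> \<Longrightarrow> f z = 0"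
  shows "f \<in> borel_measurable borel"
proof -
  have "f = (\<lambda>z. if z \<in> \<D> then f z else 0)" using assms(2) by auto
  then show ?thesis using borel_measurable_disc_extension[OF assms(1)] by simp
qed

lemma kernel_measurable: "w \<in> \<D> \<Longrightarrow> kernel w \<in> borel_measurable borel"
  by (rule extension_measurable) (auto intro: kernel_holomorphic)

text \<open>Termwise integration, dominated by |g| times the convergent series of
  \<open>|w|^n / moment n\<close>. With \<phi> the identity it yields the reproducing property; with
  \<phi> = \<Phi> it shows that a pairing with composed kernels is holomorphic in w.\<close>

lemma integral_kernel_sums:
  assumes g: "integrable M g" and [measurable]: "\<phi> \<in> borel_measurable borel"
    and \<phi>: "\<And>z. z \<in> \<D> \<Longrightarrow> \<phi> z \<in> \<D>" and w: "w \<in> \<D>"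
  shows "(\<lambda>n. (LINT z|M. g z * cnj (\<phi> z) ^ n) / of_real (moment n) * w ^ n)
     sums (LINT z|M. g z * cnj (kernel w (\<phi> z)))"
proof -
  have [measurable]: "g \<in> borel_measurable borel" using g by auto
  have [measurable]: "kernel w \<in> borel_measurable borel" by (rule kernel_measurable[OF w])
  define f where "f = (\<lambda>n z. g z * (w ^ n * cnj (\<phi> z) ^ n / of_real (moment n)))"
  have fle: "cmod (f n z) \<le> cmod (g z) * (cmod w ^ n / moment n)" if "z \<in> \<D>" for n z
  proof -
    have "cmod (\<phi> z) ^ n \<le> 1" using \<phi>[OF that] by (simp add: power_le_one)
    then have "cmod w ^ n * cmod (\<phi> z) ^ n \<le> cmod w ^ n" by (simp add: mult_left_le)
    then show ?thesis
      unfolding f_def using moment_pos[of n]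
      by (simp add: norm_mult norm_divide norm_power mult_left_mono divide_right_mono less_imp_le)
  qed
  have fi: "integrable M (f n)" for n
    unfolding f_def
  proof (rule bounded_mult_integrable[OF g])
    fix z assume z: "z \<in> \<D>"
    have "cmod (\<phi> z) ^ n \<le> 1" using \<phi>[OF z] by (simp add: power_le_one)
    then have "cmod w ^ n * cmod (\<phi> z) ^ n \<le> cmod w ^ n" by (simp add: mult_left_le)
    then show "cmod (w ^ n * cnj (\<phi> z) ^ n / of_real (moment n)) \<le> cmod w ^ n / moment n"
      using moment_pos[of n] by (simp add: norm_mult norm_divide norm_power divide_right_mono less_imp_le)
  qed measurable
  have "(\<lambda>n. LINT z|M. f n z) sums (LINT z|M. (\<Sum>n. f n z))"
  proof (rule sums_integral[OF fi])
    have sw: "summable (\<lambda>n. cmod w ^ n / moment n)" using w by (intro kernel_summable) auto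
    show "AE z in M. summable (\<lambda>n. norm (f n z))"
      using AE_bergman_disc
    proof eventually_elim
      fix z assume "z \<in> \<D>"
      then show "summable (\<lambda>n. norm (f n z))"
        using fle[of z]
        by (intro summable_comparison_test'[OF summable_mult[OF sw, of "cmod (g z)"], of 0]) simp
    qed
    show "summable (\<lambda>n. LINT z|M. norm (f n z))"
    proof (rule summable_comparison_test'[OF summable_mult[OF sw, of "LINT z|M. cmod (g z)"]])
      fix n
      have "norm (LINT z|M. norm (f n z)) = (LINT z|M. norm (f n z))" by simp
      also have "\<dots> \<le> (LINT z|M. cmod (g z) * (cmod w ^ n / moment n))"
      proof (rule integral_mono_AE)
        show "AE z in M. norm (f n z) \<le> cmod (g z) * (cmod w ^ n / moment n)"
          using AE_bergman_disc by eventually_elim (rule fle)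
      qed (use fi g in auto)
      also have "\<dots> = (LINT z|M. cmod (g z)) * (cmod w ^ n / moment n)"
        by simp
      finally show "norm (LINT z|M. norm (f n z)) \<le> (LINT z|M. cmod (g z)) * (cmod w ^ n / moment n)" .
    qed
  qed
  moreover have "(LINT z|M. (\<Sum>n. f n z)) = (LINT z|M. g z * cnj (kernel w (\<phi> z)))"
  proof (rule integral_cong_disc)
    fix z assume z: "z \<in> \<D>"
    have "(\<lambda>n. g z * cnj ((cnj w * \<phi> z) ^ n / of_real (moment n))) sums (g z * cnj (kernel w (\<phi> z)))"
      by (intro sums_mult bounded_linear.sums[OF bounded_linear_cnj] kernel_sums w \<phi> z)
    then have "(\<lambda>n. f n z) sums (g z * cnj (kernel w (\<phi> z)))"
      by (simp add: f_def power_mult_distrib)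
    then show "(\<Sum>n. f n z) = g z * cnj (kernel w (\<phi> z))" by (simp add: sums_iff)
  qed (simp_all add: f_def)
  moreover have "(LINT z|M. f n z) = (LINT z|M. g z * cnj (\<phi> z) ^ n) / of_real (moment n) * w ^ n" for n
  proof -
    have "f n = (\<lambda>z. g z * cnj (\<phi> z) ^ n * (w ^ n / of_real (moment n)))"
      by (auto simp: f_def)
    then show ?thesis by simp
  qed
  ultimately show ?thesis by simp
qed

text \<open>Averaging over rotations replaces the integrand by its circle means, given by
  \<open>disc_Taylor_coeff\<close>. This contains the orthogonality of the monomials.\<close>

lemma Taylor_coeff_integral:
  assumes f: "f holomorphic_on \<D>" and fi: "integrable M f"
  shows "(LINT z|M. f z * cnj z ^ n) = (deriv ^^ n) f 0 / fact n * of_real (moment n)"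
proof -
  have [measurable]: "f \<in> borel_measurable borel" using fi by auto
  have i: "integrable M (\<lambda>z. f z * cnj z ^ n)"
    by (rule bounded_mult_integrable[OF fi, where B = 1]) (auto simp: norm_power power_le_one)
  define G where "G = (\<lambda>z. LINT t|circle_measure. f (cis (2 * pi * t) * z) * cnj (cis (2 * pi * t) * z) ^ n)"
  have G: "G z = (deriv ^^ n) f 0 / fact n * of_real (cmod z ^ (2 * n))" if z: "z \<in> \<D>" for z
    unfolding G_def
  proof (rule circle_measure_has_integral(2)[OF _ _ disc_Taylor_coeff[OF f z]])
    have "continuous_on {0..1} (\<lambda>t. f (cis (2 * pi * t) * z))"
      by (rule continuous_on_compose2[OF holomorphic_on_imp_continuous_on[OF f]])
        (use z in \<open>auto intro!: continuous_intros simp: norm_mult\<close>)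
    then show "continuous_on {0..1} (\<lambda>t. f (cis (2 * pi * t) * z) * cnj (cis (2 * pi * t) * z) ^ n)"
      by (intro continuous_intros)
  qed measurable
  interpret C: prob_space circle_measure by (rule prob_space_circle_measure)
  have [measurable]: "G \<in> borel_measurable borel"
    unfolding G_def by measurable
  have "(LINT z|M. f z * cnj z ^ n) = (LINT z|M. G z)"
    unfolding G_def by (rule integral_bergman_average[OF alpha i])
  also have "\<dots> = (LINT z|M. (deriv ^^ n) f 0 / fact n * of_real (cmod z ^ (2 * n)))"
    by (rule integral_cong_disc[OF G]) measurable
  also have "\<dots> = (deriv ^^ n) f 0 / fact n * (LINT z|M. of_real (cmod z ^ (2 * n)))"
    by (rule integral_mult_right_zero)
  also have "(LINT z|M. complex_of_real (cmod z ^ (2 * n))) = of_real (moment n)"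
    unfolding moment_def by (rule integral_complex_of_real)
  finally show ?thesis .
qed

text \<open>Both sides are sums of the Taylor series of f at w. The hypothesis is integrability
  because f will also be a composition \<open>comp_op \<Psi> h\<close>.\<close>

lemma kernel_reproducing:
  assumes f: "f holomorphic_on \<D>" and fi: "integrable M f" and w: "w \<in> \<D>"
  shows "bergman_inner \<alpha> f (kernel w) = f w"
proof -
  have "(\<lambda>n. (LINT z|M. f z * cnj z ^ n) / of_real (moment n) * w ^ n) sums (LINT z|M. f z * cnj (kernel w z))"
    by (rule integral_kernel_sums[OF fi _ _ w]) auto
  then have "(\<lambda>n. (deriv ^^ n) f 0 / fact n * (w - 0) ^ n) sums (LINT z|M. f z * cnj (kernel w z))"
    by (simp add: Taylor_coeff_integral[OF f fi])
  moreover have "(\<lambda>n. (deriv ^^ n) f 0 / fact n * (w - 0) ^ n) sums f w"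
    by (rule holomorphic_power_series[OF f w])
  ultimately show ?thesis
    unfolding bergman_inner_def by (rule sums_unique2)
qed

end

section \<open>The Bergman space and adjoints\<close>

lemma comp_op_holomorphic:
  assumes "h holomorphic_on \<D>" "\<Psi> holomorphic_on \<D>" "\<Psi> \<in> \<D> \<rightarrow> \<D>"
  shows "comp_op \<Psi> h holomorphic_on \<D>"
proof (rule holomorphic_transform)
  show "h \<circ> \<Psi> holomorphic_on \<D>"
    by (rule holomorphic_on_compose_gen[OF assms(2,1)]) (use assms(3) in auto)
qed (simp add: comp_op_def)

lemma comp_op_outside [simp]: "z \<notin> \<D> \<Longrightarrow> comp_op \<Psi> h z = 0"
  by (simp add: comp_op_def)

lemma comp_op_apply: "z \<in> \<D> \<Longrightarrow> comp_op \<Psi> h z = h (\<Psi> z)"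
  by (simp add: comp_op_def)

lemma comp_op_linear:
  "comp_op \<Phi> (\<lambda>z. f z + c * g z) = (\<lambda>z. comp_op \<Phi> f z + c * comp_op \<Phi> g z)"
  by (auto simp: comp_op_def)

context bergman_weight
begin

lemma spaceD:
  assumes "f \<in> bergman_space \<alpha>"
  shows "f holomorphic_on \<D>" "\<And>z. z \<notin> \<D> \<Longrightarrow> f z = 0"
    "f \<in> borel_measurable borel" "integrable M (\<lambda>z. (cmod (f z))\<^sup>2)" "integrable M f"
proof -
  show 1: "f holomorphic_on \<D>" and 2: "\<And>z. z \<notin> \<D> \<Longrightarrow> f z = 0"
    and i: "integrable M (\<lambda>z. (cmod (f z))\<^sup>2)"
    using assms by (auto simp: bergman_space_def)
  show m [measurable]: "f \<in> borel_measurable borel" by (rule extension_measurable[OF 1 2])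
  show "integrable M f"
  proof (rule Bochner_Integration.integrable_bound)
    show "integrable M (\<lambda>z. 1 + (cmod (f z))\<^sup>2)" using i by simp
    have "x \<le> 1 + x\<^sup>2" for x :: real
      using zero_le_power2[of "x - 1/2"] by (simp add: power2_eq_square algebra_simps)
    then show "AE z in M. norm (f z) \<le> norm (1 + (cmod (f z))\<^sup>2)"
      by (intro AE_I2) (simp add: add_nonneg_nonneg)
  qed simp
qed

lemma bounded_in_space:
  assumes "f holomorphic_on \<D>" "\<And>z. z \<notin> \<D> \<Longrightarrow> f z = 0" "\<And>z. z \<in> \<D> \<Longrightarrow> cmod (f z) \<le> B"
  shows "f \<in> bergman_space \<alpha>"
proof -
  have [measurable]: "f \<in> borel_measurable borel" by (rule extension_measurable) fact+
  have "integrable M (\<lambda>z. (cmod (f z))\<^sup>2)"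
    by (rule bounded_integrable[where B = "B\<^sup>2"]) (use assms(3) in \<open>auto intro!: power_mono\<close>)
  then show ?thesis using assms by (simp add: bergman_space_def)
qed

lemma kernel_in_space: "w \<in> \<D> \<Longrightarrow> kernel w \<in> bergman_space \<alpha>"
  by (rule bounded_in_space[OF kernel_holomorphic _ kernel_bound]) auto

section \<open>Inner products, norms and polarisation\<close>

lemma inner_integrable:
  assumes "f \<in> bergman_space \<alpha>" "g \<in> bergman_space \<alpha>"
  shows "integrable M (\<lambda>z. f z * cnj (g z))"
proof (rule Bochner_Integration.integrable_bound)
  have [measurable]: "f \<in> borel_measurable borel" "g \<in> borel_measurable borel"
    using assms spaceD(3) by auto
  show "(\<lambda>z. f z * cnj (g z)) \<in> borel_measurable M" by measurable
  show "integrable M (\<lambda>z. (cmod (f z))\<^sup>2 + (cmod (g z))\<^sup>2)"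
    using assms spaceD(4) by simp
  have "x * y \<le> x\<^sup>2 + y\<^sup>2" if "0 \<le> x" "0 \<le> y" for x y :: real
    using that sum_squares_bound[of x y] mult_nonneg_nonneg[OF that] by linarith
  then show "AE z in M. norm (f z * cnj (g z)) \<le> norm ((cmod (f z))\<^sup>2 + (cmod (g z))\<^sup>2)"
    by (intro AE_I2) (simp add: norm_mult)
qed

lemma norm_square: "(bergman_norm \<alpha> f)\<^sup>2 = (LINT z|M. (cmod (f z))\<^sup>2)"
  unfolding bergman_norm_def by (simp add: integral_nonneg_AE)

lemma inner_self: "bergman_inner \<alpha> f f = of_real ((bergman_norm \<alpha> f)\<^sup>2)"
  unfolding norm_square bergman_inner_def
  by (simp only: complex_norm_square[symmetric] integral_complex_of_real)

lemma norm_square_inner: "(bergman_norm \<alpha> f)\<^sup>2 = Re (bergman_inner \<alpha> f f)"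
  by (simp only: inner_self Re_complex_of_real)

lemma inner_cnj: "bergman_inner \<alpha> g f = cnj (bergman_inner \<alpha> f g)"
proof -
  have "(LINT z|M. cnj (f z * cnj (g z))) = cnj (LINT z|M. f z * cnj (g z))"
    by (rule Bochner_Integration.integral_cnj)
  then show ?thesis by (simp add: bergman_inner_def mult.commute)
qed

lemma lincomb_norm_square:
  fixes f g :: "complex \<Rightarrow> complex"
  shows "(cmod (f z + c * g z))\<^sup>2
    = (cmod (f z))\<^sup>2 + 2 * Re (cnj c * (f z * cnj (g z))) + (cmod c)\<^sup>2 * (cmod (g z))\<^sup>2"
  by (simp add: cmod_power2, simp add: power2_eq_square algebra_simps)

lemma inner_integrable_terms:
  assumes "f \<in> bergman_space \<alpha>" "g \<in> bergman_space \<alpha>"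
  shows "integrable M (\<lambda>z. 2 * Re (cnj c * (f z * cnj (g z))))"
    and "integrable M (\<lambda>z. (cmod c)\<^sup>2 * (cmod (g z))\<^sup>2)"
proof -
  have "integrable M (\<lambda>z. cnj c * (f z * cnj (g z)))"
    using inner_integrable[OF assms] by simp
  then show "integrable M (\<lambda>z. 2 * Re (cnj c * (f z * cnj (g z))))"
    using integrable_Re by (intro integrable_mult_right) blast
  show "integrable M (\<lambda>z. (cmod c)\<^sup>2 * (cmod (g z))\<^sup>2)"
    using spaceD(4)[OF assms(2)] by simp
qed

lemma space_lincomb:
  assumes "f \<in> bergman_space \<alpha>" "g \<in> bergman_space \<alpha>"
  shows "(\<lambda>z. f z + c * g z) \<in> bergman_space \<alpha>"
proof -
  note i = inner_integrable_terms[OF assms, of c]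
  have "integrable M (\<lambda>z. (cmod (f z + c * g z))\<^sup>2)"
    unfolding lincomb_norm_square
    by (intro Bochner_Integration.integrable_add i spaceD(4) assms)
  moreover have "(\<lambda>z. f z + c * g z) holomorphic_on \<D>"
    by (intro holomorphic_intros spaceD(1) assms)
  ultimately show ?thesis
    using spaceD(2)[OF assms(1)] spaceD(2)[OF assms(2)] by (simp add: bergman_space_def)
qed

lemma norm_lincomb:
  assumes "f \<in> bergman_space \<alpha>" "g \<in> bergman_space \<alpha>"
  shows "(bergman_norm \<alpha> (\<lambda>z. f z + c * g z))\<^sup>2
    = (bergman_norm \<alpha> f)\<^sup>2 + 2 * Re (cnj c * bergman_inner \<alpha> f g) + (cmod c)\<^sup>2 * (bergman_norm \<alpha> g)\<^sup>2"
proof -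
  note i = spaceD(4)[OF assms(1)] spaceD(4)[OF assms(2)] inner_integrable[OF assms]
  have i3: "integrable M (\<lambda>z. cnj c * (f z * cnj (g z)))" using i(3) by simp
  note i4 = inner_integrable_terms(1)[OF assms, of c] and i5 = inner_integrable_terms(2)[OF assms, of c]
  have "(bergman_norm \<alpha> (\<lambda>z. f z + c * g z))\<^sup>2
     = (LINT z|M. (cmod (f z))\<^sup>2 + 2 * Re (cnj c * (f z * cnj (g z))) + (cmod c)\<^sup>2 * (cmod (g z))\<^sup>2)"
    unfolding norm_square lincomb_norm_square ..
  also have "\<dots> = (LINT z|M. (cmod (f z))\<^sup>2) + (LINT z|M. 2 * Re (cnj c * (f z * cnj (g z))))
      + (LINT z|M. (cmod c)\<^sup>2 * (cmod (g z))\<^sup>2)"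
    using Bochner_Integration.integral_add[OF Bochner_Integration.integrable_add[OF i(1) i4] i5]
      Bochner_Integration.integral_add[OF i(1) i4] by (simp only:)
  also have "(LINT z|M. 2 * Re (cnj c * (f z * cnj (g z)))) = 2 * Re (LINT z|M. cnj c * (f z * cnj (g z)))"
    using integral_Re[OF i3] by (simp only: integral_mult_right_zero)
  finally show ?thesis
    unfolding norm_square bergman_inner_def by (simp only: integral_mult_right_zero)
qed

lemma norm_zero_imp:
  assumes f: "f \<in> bergman_space \<alpha>" and 0: "bergman_norm \<alpha> f = 0"
  shows "f z = 0"
proof (cases "z \<in> \<D>")
  case True
  have "(LINT z|M. (cmod (f z))\<^sup>2) = 0" using 0 norm_square[of f] by simp
  then have "(cmod (f z))\<^sup>2 = 0"
    using integral_eq_0_imp_zero[OF spaceD(4)[OF f] _ _ _ True]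
    by (simp add: continuous_on_power continuous_on_norm holomorphic_on_imp_continuous_on spaceD(1)[OF f])
  then show ?thesis by simp
qed (use spaceD(2)[OF f] in simp)

lemma inner_lincomb_right:
  assumes "integrable M (\<lambda>z. h z * cnj (f z))" "integrable M (\<lambda>z. h z * cnj (g z))"
  shows "bergman_inner \<alpha> h (\<lambda>z. f z + c * g z) = bergman_inner \<alpha> h f + cnj c * bergman_inner \<alpha> h g"
proof -
  have "bergman_inner \<alpha> h (\<lambda>z. f z + c * g z)
      = (LINT z|M. h z * cnj (f z) + cnj c * (h z * cnj (g z)))"
    unfolding bergman_inner_def by (simp add: algebra_simps)
  also have "\<dots> = (LINT z|M. h z * cnj (f z)) + (LINT z|M. cnj c * (h z * cnj (g z)))"
    using assms by (intro Bochner_Integration.integral_add) simp_all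
  finally show ?thesis unfolding bergman_inner_def by (simp only: integral_mult_right_zero)
qed

text \<open>Polarisation with c = 1 and c = \<i>. Additivity is a hypothesis on this one pair
  because T may contain an adjoint whose values are known only at selected functions.\<close>

lemma isometry_inner:
  assumes iso: "bergman_isometry \<alpha> T" and fg: "f \<in> bergman_space \<alpha>" "g \<in> bergman_space \<alpha>"
    and lin: "\<And>c. T (\<lambda>z. f z + c * g z) = (\<lambda>z. T f z + c * T g z)"
  shows "bergman_inner \<alpha> (T f) (T g) = bergman_inner \<alpha> f g"
proof -
  have Tfg: "T f \<in> bergman_space \<alpha>" "T g \<in> bergman_space \<alpha>"
    "bergman_norm \<alpha> (T f) = bergman_norm \<alpha> f" "bergman_norm \<alpha> (T g) = bergman_norm \<alpha> g"
    using iso fg by (auto simp: bergman_isometry_def)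
  have "bergman_norm \<alpha> (\<lambda>z. T f z + c * T g z) = bergman_norm \<alpha> (\<lambda>z. f z + c * g z)" for c
    using iso space_lincomb[OF fg, of c] unfolding bergman_isometry_def lin[symmetric] by blast
  then have "Re (cnj c * bergman_inner \<alpha> (T f) (T g)) = Re (cnj c * bergman_inner \<alpha> f g)" for c
    using norm_lincomb[OF fg, of c] norm_lincomb[OF Tfg(1,2), of c] Tfg(3,4) by simp
  from this[of 1] this[of \<i>] show ?thesis by (simp add: complex_eq_iff)
qed

text \<open>The defining property of an adjoint value, separated from the definite description so
  that it can be checked for an explicit g.\<close>

definition adjoint_rel :: "((complex \<Rightarrow> complex) \<Rightarrow> (complex \<Rightarrow> complex)) \<Rightarrow> (complex \<Rightarrow> complex) \<Rightarrow> (complex \<Rightarrow> complex) \<Rightarrow> bool"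
  where "adjoint_rel T f g \<longleftrightarrow> g \<in> bergman_space \<alpha> \<and>
     (\<forall>h\<in>bergman_space \<alpha>. bergman_inner \<alpha> (T h) f = bergman_inner \<alpha> h g)"

text \<open>Uniqueness: the difference of two candidates lies in the space and, tested against
  itself, has norm 0.\<close>

lemma adjoint_eq:
  assumes "adjoint_rel T f g"
  shows "bergman_adjoint \<alpha> T f = g"
  unfolding bergman_adjoint_def
proof (rule the_equality)
  show "g \<in> bergman_space \<alpha> \<and> (\<forall>h\<in>bergman_space \<alpha>. bergman_inner \<alpha> (T h) f = bergman_inner \<alpha> h g)"
    using assms by (simp add: adjoint_rel_def)
  fix g' assume g': "g' \<in> bergman_space \<alpha> \<and> (\<forall>h\<in>bergman_space \<alpha>. bergman_inner \<alpha> (T h) f = bergman_inner \<alpha> h g')"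
  have g: "g \<in> bergman_space \<alpha>" using assms by (simp add: adjoint_rel_def)
  define d where "d = (\<lambda>z. g' z + (-1) * g z)"
  have d: "d \<in> bergman_space \<alpha>" unfolding d_def using g g' by (intro space_lincomb) auto
  have "bergman_inner \<alpha> d g' = bergman_inner \<alpha> d g"
    using g' assms d by (auto simp: adjoint_rel_def)
  moreover have "bergman_inner \<alpha> d d = bergman_inner \<alpha> d g' + cnj (-1) * bergman_inner \<alpha> d g"
    using d g g' unfolding d_def by (intro inner_lincomb_right inner_integrable) auto
  ultimately have "bergman_norm \<alpha> d = 0" by (simp add: inner_self)
  then have "d z = 0" for z using norm_zero_imp d by blast
  then show "g' = g" by (auto simp: d_def fun_eq_iff)
qed

text \<open>Two uses of the reproducing property: both pairings evaluate h at \<Psi> w.\<close>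

lemma adjoint_kernel:
  assumes \<Psi>: "\<Psi> holomorphic_on \<D>" "\<Psi> \<in> \<D> \<rightarrow> \<D>" and w: "w \<in> \<D>"
  shows "adjoint_rel (comp_op \<Psi>) (kernel w) (kernel (\<Psi> w))"
  unfolding adjoint_rel_def
proof (intro conjI ballI)
  have \<Psi>w: "\<Psi> w \<in> \<D>" using \<Psi>(2) w by auto
  then show "kernel (\<Psi> w) \<in> bergman_space \<alpha>" by (rule kernel_in_space)
  fix h assume h: "h \<in> bergman_space \<alpha>"
  have "bergman_inner \<alpha> (comp_op \<Psi> h) (kernel w) = comp_op \<Psi> h w"
    by (intro kernel_reproducing comp_op_holomorphic integrable_comp_op alpha spaceD[OF h] \<Psi> w)
  also have "\<dots> = bergman_inner \<alpha> h (kernel (\<Psi> w))"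
    using kernel_reproducing[OF spaceD(1)[OF h] spaceD(5)[OF h] \<Psi>w] w by (simp add: comp_op_apply)
  finally show "bergman_inner \<alpha> (comp_op \<Psi> h) (kernel w) = bergman_inner \<alpha> h (kernel (\<Psi> w))" .
qed

text \<open>The bounds make the pairings with \<open>comp_op \<Psi> h\<close>, known here to be
  integrable, split into sums.\<close>

lemma adjoint_lincomb:
  assumes \<Psi>: "\<Psi> holomorphic_on \<D>" "\<Psi> \<in> \<D> \<rightarrow> \<D>"
    and f: "f\<^sub>1 \<in> bergman_space \<alpha>" "f\<^sub>2 \<in> bergman_space \<alpha>"
    and B: "\<forall>z\<in>\<D>. cmod (f\<^sub>1 z) \<le> B\<^sub>1" "\<forall>z\<in>\<D>. cmod (f\<^sub>2 z) \<le> B\<^sub>2"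
    and adj: "adjoint_rel (comp_op \<Psi>) f\<^sub>1 g\<^sub>1" "adjoint_rel (comp_op \<Psi>) f\<^sub>2 g\<^sub>2"
  shows "adjoint_rel (comp_op \<Psi>) (\<lambda>z. f\<^sub>1 z + c * f\<^sub>2 z) (\<lambda>z. g\<^sub>1 z + c * g\<^sub>2 z)"
  unfolding adjoint_rel_def
proof (intro conjI ballI)
  have g: "g\<^sub>1 \<in> bergman_space \<alpha>" "g\<^sub>2 \<in> bergman_space \<alpha>"
    using adj by (auto simp: adjoint_rel_def)
  then show "(\<lambda>z. g\<^sub>1 z + c * g\<^sub>2 z) \<in> bergman_space \<alpha>" by (rule space_lincomb)
  fix h assume h: "h \<in> bergman_space \<alpha>"
  have i: "integrable M (comp_op \<Psi> h)"
    by (intro integrable_comp_op alpha spaceD[OF h] \<Psi>)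
  have [measurable]: "f\<^sub>1 \<in> borel_measurable borel" "f\<^sub>2 \<in> borel_measurable borel"
    using f by (auto intro: spaceD)
  have "bergman_inner \<alpha> (comp_op \<Psi> h) (\<lambda>z. f\<^sub>1 z + c * f\<^sub>2 z)
     = bergman_inner \<alpha> (comp_op \<Psi> h) f\<^sub>1 + cnj c * bergman_inner \<alpha> (comp_op \<Psi> h) f\<^sub>2"
    by (intro inner_lincomb_right bounded_mult_integrable[OF i, where B = B\<^sub>1]
        bounded_mult_integrable[OF i, where B = B\<^sub>2]) (use B in simp_all)
  also have "\<dots> = bergman_inner \<alpha> h g\<^sub>1 + cnj c * bergman_inner \<alpha> h g\<^sub>2"
    using adj h by (simp add: adjoint_rel_def)
  also have "\<dots> = bergman_inner \<alpha> h (\<lambda>z. g\<^sub>1 z + c * g\<^sub>2 z)"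
    by (intro inner_lincomb_right[symmetric] inner_integrable h g)
  finally show "bergman_inner \<alpha> (comp_op \<Psi> h) (\<lambda>z. f\<^sub>1 z + c * f\<^sub>2 z) = bergman_inner \<alpha> h (\<lambda>z. g\<^sub>1 z + c * g\<^sub>2 z)" .
qed

section \<open>The coordinate function and equality in the Schwarz lemma\<close>

definition coord :: "complex \<Rightarrow> complex"
  where "coord z = (if z \<in> \<D> then z else 0)"

lemma coord_holomorphic: "coord holomorphic_on \<D>"
  by (rule holomorphic_transform[of "\<lambda>z. z"]) (auto simp: coord_def intro!: holomorphic_intros)

lemma coord_bound: "z \<in> \<D> \<Longrightarrow> cmod (coord z) \<le> 1"
  by (simp add: coord_def)

lemma coord_in_space: "coord \<in> bergman_space \<alpha>"
  by (rule bounded_in_space[OF coord_holomorphic _ coord_bound]) (auto simp: coord_def)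

lemma inner_coord:
  assumes "f holomorphic_on \<D>" "integrable M f"
  shows "bergman_inner \<alpha> f coord = deriv f 0 * of_real (moment 1)"
proof -
  have [measurable]: "f \<in> borel_measurable borel" "coord \<in> borel_measurable borel"
    using assms(2) spaceD(3)[OF coord_in_space] by auto
  have "bergman_inner \<alpha> f coord = (LINT z|M. f z * cnj z ^ 1)"
    unfolding bergman_inner_def by (rule integral_cong_disc) (simp_all add: coord_def)
  then show ?thesis using Taylor_coeff_integral[OF assms, of 1] by simp
qed

lemma norm_coord: "(bergman_norm \<alpha> coord)\<^sup>2 = moment 1"
proof -
  have [measurable]: "coord \<in> borel_measurable borel" using spaceD(3)[OF coord_in_space] .
  show ?thesis
    unfolding norm_square moment_def by (rule integral_cong_disc) (simp_all add: coord_def)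
qed

lemma inner_coord_kernel: "w \<in> \<D> \<Longrightarrow> bergman_inner \<alpha> coord (kernel w) = w"
  using kernel_reproducing[OF coord_holomorphic spaceD(5)[OF coord_in_space]] by (simp add: coord_def)

lemma kernel_eq_one_imp:
  assumes "w \<in> \<D>" "kernel w = kernel 0"
  shows "w = 0"
  using inner_coord_kernel[OF assms(1)] inner_coord_kernel[of 0] assms(2) by simp

lemma inner_kernel_0:
  assumes "f \<in> bergman_space \<alpha>"
  shows "bergman_inner \<alpha> f (kernel 0) = f 0"
  using kernel_reproducing[OF spaceD(1)[OF assms] spaceD(5)[OF assms], of 0] by simp

text \<open>The Schwarz lemma gives |\<Phi> z| <= |z| pointwise. If the integrals of the squares
  agree, the continuous nonnegative difference vanishes identically, so equality holds at the
  nonzero point 1/2, and the Schwarz lemma yields a rotation.\<close>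

lemma rotation_if_norm_preserved:
  assumes \<Phi>: "\<Phi> holomorphic_on \<D>" "\<Phi> \<in> \<D> \<rightarrow> \<D>" "\<Phi> 0 = 0"
  shows "(bergman_norm \<alpha> (comp_op \<Phi> coord))\<^sup>2 \<le> moment 1"
    and "(bergman_norm \<alpha> (comp_op \<Phi> coord))\<^sup>2 = moment 1 \<Longrightarrow> is_rotation \<Phi>"
proof -
  have ce: "comp_op \<Phi> coord z = \<Phi> z" if "z \<in> \<D>" for z
    using \<Phi>(2) that by (auto simp: comp_op_def coord_def Pi_iff)
  have no: "cmod (\<Phi> z) < 1" if "cmod z < 1" for z
    using \<Phi>(2) that by (auto simp: Pi_iff)
  note Schwarz = Schwarz_Lemma[OF \<Phi>(1,3) no]
  have s: "comp_op \<Phi> coord \<in> bergman_space \<alpha>"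
    by (rule bounded_in_space[where B = 1])
      (use no in \<open>auto simp: ce less_imp_le intro!: comp_op_holomorphic coord_holomorphic \<Phi>\<close>)
  define u where "u = (\<lambda>z. (cmod (coord z))\<^sup>2 - (cmod (comp_op \<Phi> coord z))\<^sup>2)"
  have i: "integrable M (\<lambda>z. (cmod (coord z))\<^sup>2)" "integrable M (\<lambda>z. (cmod (comp_op \<Phi> coord z))\<^sup>2)"
    by (rule spaceD(4)[OF coord_in_space], rule spaceD(4)[OF s])
  have ui: "integrable M u" unfolding u_def using i by (rule Bochner_Integration.integrable_diff)
  have ueq: "(LINT z|M. u z) = moment 1 - (bergman_norm \<alpha> (comp_op \<Phi> coord))\<^sup>2"
    unfolding u_def Bochner_Integration.integral_diff[OF i] norm_coord[symmetric] norm_square ..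
  have upos: "u z \<ge> 0" if z: "z \<in> \<D>" for z
  proof -
    have "cmod (\<Phi> z) \<le> cmod z" using Schwarz(1)[of z] z by simp
    then show ?thesis using z by (simp add: u_def ce, simp add: coord_def power_mono)
  qed
  have "0 \<le> (LINT z|M. u z)"
    using AE_bergman_disc[of \<alpha>] by (intro integral_nonneg_AE) (auto elim!: eventually_mono intro: upos)
  then show "(bergman_norm \<alpha> (comp_op \<Phi> coord))\<^sup>2 \<le> moment 1" using ueq by simp
  assume "(bergman_norm \<alpha> (comp_op \<Phi> coord))\<^sup>2 = moment 1"
  then have u0: "(LINT z|M. u z) = 0" using ueq by simp
  have cont: "continuous_on \<D> u"
    unfolding u_def
    by (intro continuous_intros holomorphic_on_imp_continuous_on[OF coord_holomorphic]
        holomorphic_on_imp_continuous_on[OF spaceD(1)[OF s]])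
  have "u (1/2) = 0"
    by (rule integral_eq_0_imp_zero[OF ui u0 cont upos]) (simp_all add: norm_divide)
  then have "(cmod (\<Phi> (1/2)))\<^sup>2 = (cmod (1/2))\<^sup>2"
    by (simp add: u_def ce norm_divide, simp add: coord_def norm_divide)
  then have "cmod (\<Phi> (1/2)) = cmod (1/2)"
    by (rule power2_eq_imp_eq) simp_all
  then have "\<exists>z. cmod z < 1 \<and> z \<noteq> 0 \<and> cmod (\<Phi> z) = cmod z"
    by (intro exI[of _ "1/2"]) (simp add: norm_divide)
  then show "is_rotation \<Phi>"
    using Schwarz(3)[of 0] unfolding is_rotation_def by auto
qed

end

section \<open>Isometries\<close>

context bergman_weight
begin

text \<open>Composition fixes the constant 1, so preserving the orthogonality of z and 1 forces
  \<Phi> 0 = 0; then the equality case applies.\<close>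

lemma isometry_imp_rotation:
  assumes \<Phi>: "\<Phi> holomorphic_on \<D>" "\<Phi> \<in> \<D> \<rightarrow> \<D>"
    and iso: "bergman_isometry \<alpha> (comp_op \<Phi>)"
  shows "is_rotation \<Phi>"
proof (rule rotation_if_norm_preserved(2)[OF \<Phi>])
  have k0: "comp_op \<Phi> (kernel 0) = kernel 0"
    using \<Phi>(2) by (auto simp: comp_op_def kernel_0 Pi_iff)
  have s: "comp_op \<Phi> coord \<in> bergman_space \<alpha>"
    using iso coord_in_space by (auto simp: bergman_isometry_def)
  have "bergman_inner \<alpha> (comp_op \<Phi> coord) (comp_op \<Phi> (kernel 0)) = bergman_inner \<alpha> coord (kernel 0)"
    by (rule isometry_inner[OF iso coord_in_space kernel_in_space comp_op_linear]) simp
  then have "comp_op \<Phi> coord 0 = 0"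
    unfolding k0 inner_kernel_0[OF s] inner_kernel_0[OF coord_in_space] by (simp add: coord_def)
  moreover have "\<Phi> 0 \<in> \<D>" using \<Phi>(2) by auto
  ultimately show "\<Phi> 0 = 0" by (simp add: comp_op_apply coord_def)
  show "(bergman_norm \<alpha> (comp_op \<Phi> coord))\<^sup>2 = moment 1"
    using iso coord_in_space norm_coord by (auto simp: bergman_isometry_def)
qed

lemma comp_op_rotation:
  assumes c: "cmod c = 1" "\<forall>z\<in>\<D>. \<Phi> z = c * z" and f: "f \<in> bergman_space \<alpha>"
  shows "comp_op \<Phi> f = (\<lambda>z. f (c * z))"
  using c spaceD(2)[OF f] by (auto simp: comp_op_def norm_mult)

lemma rotation_in_space:
  assumes c: "cmod c = 1" and f: "f \<in> bergman_space \<alpha>"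
  shows "(\<lambda>z. f (c * z)) \<in> bergman_space \<alpha>" "bergman_norm \<alpha> (\<lambda>z. f (c * z)) = bergman_norm \<alpha> f"
proof -
  have [measurable]: "f \<in> borel_measurable borel" by (rule spaceD(3)[OF f])
  have m: "(\<lambda>z. (cmod (f z))\<^sup>2) \<in> borel_measurable M" by measurable
  show "bergman_norm \<alpha> (\<lambda>z. f (c * z)) = bergman_norm \<alpha> f"
    unfolding bergman_norm_def by (simp only: integral_bergman_rotate(1)[OF m c])
  have "integrable M (\<lambda>z. (cmod (f (c * z)))\<^sup>2)"
    using integral_bergman_rotate(2)[OF m c] spaceD(4)[OF f] by simp
  moreover have "(\<lambda>z. f (c * z)) holomorphic_on \<D>"
    by (rule holomorphic_on_compose_gen[OF _ spaceD(1)[OF f], unfolded o_def])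
      (auto intro!: holomorphic_intros simp: norm_mult c)
  moreover have "f (c * z) = 0" if "z \<notin> \<D>" for z
    using that c by (intro spaceD(2)[OF f]) (simp add: norm_mult)
  ultimately show "(\<lambda>z. f (c * z)) \<in> bergman_space \<alpha>"
    by (simp add: bergman_space_def)
qed

lemma rotation_imp_isometry:
  assumes "is_rotation \<Phi>"
  shows "bergman_isometry \<alpha> (comp_op \<Phi>)"
proof -
  obtain c where c: "cmod c = 1" "\<forall>z\<in>\<D>. \<Phi> z = c * z"
    using assms by (auto simp: is_rotation_def)
  show ?thesis
    unfolding bergman_isometry_def
    using comp_op_rotation[OF c] rotation_in_space[OF c(1)] by simp
qed

text \<open>A rotation preserves the measure, so the change of variables moves it to the other
  factor as the inverse rotation. Here f ranges over the whole space, as the converse direction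
  requires.\<close>

lemma adjoint_rotation:
  assumes c: "cmod c = 1" "\<forall>z\<in>\<D>. \<Psi> z = c * z" and f: "f \<in> bergman_space \<alpha>"
  shows "adjoint_rel (comp_op \<Psi>) f (\<lambda>z. f (cnj c * z))"
  unfolding adjoint_rel_def
proof (intro conjI ballI)
  have cc: "cmod (cnj c) = 1" using c by simp
  show "(\<lambda>z. f (cnj c * z)) \<in> bergman_space \<alpha>"
    by (rule rotation_in_space(1)[OF cc f])
  fix h assume h: "h \<in> bergman_space \<alpha>"
  have [measurable]: "f \<in> borel_measurable borel" "h \<in> borel_measurable borel"
    using spaceD(3) f h by auto
  have m: "(\<lambda>z. h z * cnj (f (cnj c * z))) \<in> borel_measurable M" by measurable
  have cz: "cnj c * (c * z) = z" for z
    using c(1) complex_norm_square[of c] by (simp add: mult.assoc[symmetric] mult.commute)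
  have "bergman_inner \<alpha> (comp_op \<Psi> h) f = (LINT z|M. h (c * z) * cnj (f (cnj c * (c * z))))"
    unfolding bergman_inner_def comp_op_rotation[OF c h] cz ..
  also have "\<dots> = bergman_inner \<alpha> h (\<lambda>z. f (cnj c * z))"
    unfolding bergman_inner_def by (rule integral_bergman_rotate(1)[OF m c(1)])
  finally show "bergman_inner \<alpha> (comp_op \<Psi> h) f = bergman_inner \<alpha> h (\<lambda>z. f (cnj c * z))" .
qed

lemma rotations_imp_product_isometry:
  assumes "is_rotation \<Phi>" "is_rotation \<Psi>"
  shows "bergman_isometry \<alpha> (comp_op \<Phi> \<circ> bergman_adjoint \<alpha> (comp_op \<Psi>))"
proof -
  obtain c where c: "cmod c = 1" "\<forall>z\<in>\<D>. \<Psi> z = c * z"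
    using assms(2) by (auto simp: is_rotation_def)
  have cc: "cmod (cnj c) = 1" using c by simp
  show ?thesis
    using rotation_imp_isometry[OF assms(1)] rotation_in_space[OF cc]
    by (simp add: bergman_isometry_def adjoint_eq[OF adjoint_rotation[OF c]])
qed

end

section \<open>Necessity: consequences of the product being an isometry\<close>

locale product_isometry = bergman_weight +
  fixes \<Phi> \<Psi> :: "complex \<Rightarrow> complex"
  assumes \<Phi>: "\<Phi> holomorphic_on \<D>" "\<Phi> \<in> \<D> \<rightarrow> \<D>"
    and \<Psi>: "\<Psi> holomorphic_on \<D>" "\<Psi> \<in> \<D> \<rightarrow> \<D>"
    and iso: "bergman_isometry \<alpha> (comp_op \<Phi> \<circ> bergman_adjoint \<alpha> (comp_op \<Psi>))"
begin

definition T :: "(complex \<Rightarrow> complex) \<Rightarrow> complex \<Rightarrow> complex"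
  where "T = comp_op \<Phi> \<circ> bergman_adjoint \<alpha> (comp_op \<Psi>)"

lemma isometry_T: "bergman_isometry \<alpha> T"
  using iso by (simp only: T_def)

lemma T_eq: "adjoint_rel (comp_op \<Psi>) f g \<Longrightarrow> T f = comp_op \<Phi> g"
  by (simp add: T_def adjoint_eq)

lemma T_kernel: "w \<in> \<D> \<Longrightarrow> T (kernel w) = comp_op \<Phi> (kernel (\<Psi> w))"
  by (rule T_eq[OF adjoint_kernel[OF \<Psi>]])

lemma maps: "z \<in> \<D> \<Longrightarrow> \<Phi> z \<in> \<D>" "z \<in> \<D> \<Longrightarrow> \<Psi> z \<in> \<D>"
  using \<Phi>(2) \<Psi>(2) by auto

lemma T_lincomb:
  assumes f: "f\<^sub>1 \<in> bergman_space \<alpha>" "f\<^sub>2 \<in> bergman_space \<alpha>"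
    and B: "\<forall>z\<in>\<D>. cmod (f\<^sub>1 z) \<le> B\<^sub>1" "\<forall>z\<in>\<D>. cmod (f\<^sub>2 z) \<le> B\<^sub>2"
    and adj: "adjoint_rel (comp_op \<Psi>) f\<^sub>1 g\<^sub>1" "adjoint_rel (comp_op \<Psi>) f\<^sub>2 g\<^sub>2"
  shows "T (\<lambda>z. f\<^sub>1 z + c * f\<^sub>2 z) = (\<lambda>z. T f\<^sub>1 z + c * T f\<^sub>2 z)"
  unfolding T_eq[OF adjoint_lincomb[OF \<Psi> f B adj]] T_eq[OF adj(1)] T_eq[OF adj(2)]
  by (rule comp_op_linear)

lemma T_kernel_lincomb:
  assumes "v \<in> \<D>" "w \<in> \<D>"
  shows "T (\<lambda>z. kernel v z + c * kernel w z) = (\<lambda>z. T (kernel v) z + c * T (kernel w) z)"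
proof -
  have "\<forall>z\<in>\<D>. cmod (kernel u z) \<le> (\<Sum>n. cmod u ^ n / moment n)" if "u \<in> \<D>" for u
    using kernel_bound[OF that] by blast
  note bound = this[OF assms(1)] this[OF assms(2)]
  show ?thesis
    by (rule T_lincomb[OF _ _ bound adjoint_kernel[OF \<Psi>] adjoint_kernel[OF \<Psi>]])
      (use assms kernel_in_space in auto)
qed

lemma T_in_space: "f \<in> bergman_space \<alpha> \<Longrightarrow> T f \<in> bergman_space \<alpha>"
  and T_norm: "f \<in> bergman_space \<alpha> \<Longrightarrow> bergman_norm \<alpha> (T f) = bergman_norm \<alpha> f"
  using isometry_T by (auto simp: bergman_isometry_def)

lemma inner_T_kernel:
  assumes "v \<in> \<D>" "w \<in> \<D>"
  shows "bergman_inner \<alpha> (T (kernel v)) (T (kernel w)) = kernel v w"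
proof -
  have "bergman_inner \<alpha> (T (kernel v)) (T (kernel w)) = bergman_inner \<alpha> (kernel v) (kernel w)"
    by (rule isometry_inner[OF isometry_T kernel_in_space kernel_in_space T_kernel_lincomb]) (use assms in auto)
  also have "\<dots> = kernel v w"
    using kernel_reproducing[OF kernel_holomorphic spaceD(5)[OF kernel_in_space]] assms by simp
  finally show ?thesis .
qed

text \<open>T preserves the norm of the difference of two kernels, and a kernel determines its
  point. Both nonconstancy proofs end in a contradiction with this.\<close>

lemma T_kernel_eq_imp:
  assumes w: "w \<in> \<D>" and eq: "T (kernel w) = T (kernel 0)"
  shows "w = 0"
proof (rule kernel_eq_one_imp[OF w])
  define d where "d = (\<lambda>z. kernel w z + (-1) * kernel 0 z)"
  have d: "d \<in> bergman_space \<alpha>"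
    unfolding d_def by (intro space_lincomb kernel_in_space w) simp
  have "T d = (\<lambda>z. 0)"
    unfolding d_def using w by (subst T_kernel_lincomb) (simp_all only: eq, auto)
  then have "bergman_norm \<alpha> (T d) = 0" by (simp add: bergman_norm_def)
  then have "bergman_norm \<alpha> d = 0" using T_norm[OF d] by simp
  then have "d z = 0" for z by (rule norm_zero_imp[OF d])
  then show "kernel w = kernel 0" by (auto simp: d_def fun_eq_iff)
qed

lemma half_disc: "(1/2 :: complex) \<in> \<D>"
  by (simp add: norm_divide)

lemma \<Psi>_nonconstant: "\<not> \<Psi> constant_on \<D>"
proof
  assume "\<Psi> constant_on \<D>"
  then have "\<Psi> (1/2) = \<Psi> 0"
    using half_disc unfolding constant_on_def by (metis centre_in_ball zero_less_one)
  then have "T (kernel (1/2)) = T (kernel 0)"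
    using half_disc by (simp only: T_kernel centre_in_ball zero_less_one)
  then show False using T_kernel_eq_imp[OF half_disc] by simp
qed

lemma inner_one_one: "bergman_inner \<alpha> (kernel 0) (kernel 0) = 1"
  by (simp add: inner_kernel_0[OF kernel_in_space] kernel_0)

text \<open>For constant \<Phi> each T (K w) is a multiple k w of 1. Its pairing with T (K 0) is K w
  0 = 1 for all w, so k is constant and T would identify distinct kernels.\<close>

lemma \<Phi>_nonconstant: "\<not> \<Phi> constant_on \<D>"
proof
  assume "\<Phi> constant_on \<D>"
  then obtain p where p: "\<And>z. z \<in> \<D> \<Longrightarrow> \<Phi> z = p"
    unfolding constant_on_def by blast
  define k where "k = (\<lambda>w. kernel (\<Psi> w) p)"
  have Tk: "T (kernel w) = (\<lambda>z. k w * kernel 0 z)" if "w \<in> \<D>" for w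
    using that p by (auto simp: T_kernel[OF that] comp_op_def kernel_0 k_def)
  have one: "k w * cnj (k 0) = 1" if w: "w \<in> \<D>" for w
  proof -
    have "bergman_inner \<alpha> (T (kernel w)) (T (kernel 0)) = 1"
      using inner_T_kernel[OF w, of 0] inner_cnj[of "kernel w" "kernel 0"] w
        inner_kernel_0[OF kernel_in_space[OF w]]
        kernel_reproducing[OF kernel_holomorphic spaceD(5)[OF kernel_in_space] w, of 0]
      by (simp add: kernel_0)
    moreover have "bergman_inner \<alpha> (T (kernel w)) (T (kernel 0))
        = (LINT z|M. (k w * cnj (k 0)) * (kernel 0 z * cnj (kernel 0 z)))"
      unfolding bergman_inner_def using w by (simp add: Tk mult_ac)
    moreover have "\<dots> = k w * cnj (k 0)"
      using inner_one_one unfolding bergman_inner_def by (simp only: integral_mult_right_zero) simp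
    ultimately show ?thesis by simp
  qed
  have "k (1/2) * cnj (k 0) = k 0 * cnj (k 0)" "cnj (k 0) \<noteq> 0"
    using one[OF half_disc] one[of 0] by auto
  then have "k (1/2) = k 0" by simp
  then have "T (kernel (1/2)) = T (kernel 0)"
    using Tk[OF half_disc] Tk[of 0] by simp
  then show False using T_kernel_eq_imp[OF half_disc] by simp
qed

lemma \<Psi>_0: "\<Psi> 0 = 0"
proof -
  \<comment> \<open>The composed kernel stands in the conjugate-linear slot: K u is antiholomorphic
    in u, hence F is holomorphic.\<close>
  define a g F where "a = \<Psi> 0" and "g = T (kernel 0)"
    and "F = (\<lambda>u. bergman_inner \<alpha> g (comp_op \<Phi> (kernel u)))"
  have a: "a \<in> \<D>" unfolding a_def by (rule maps) simp
  have g: "g \<in> bergman_space \<alpha>" unfolding g_def by (intro T_in_space kernel_in_space) simp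
  have g_eq: "g = comp_op \<Phi> (kernel a)" unfolding g_def a_def by (rule T_kernel) simp
  define \<phi> where "\<phi> = (\<lambda>z. if z \<in> \<D> then \<Phi> z else 0)"
  have \<phi>m [measurable]: "\<phi> \<in> borel_measurable borel"
    unfolding \<phi>_def by (rule borel_measurable_disc_extension[OF \<Phi>(1)])
  have \<phi>D: "\<phi> z \<in> \<D>" if "z \<in> \<D>" for z using maps(1)[OF that] that by (simp add: \<phi>_def)
  have F_hol: "F holomorphic_on \<D>"
  proof (rule power_series_holomorphic)
    fix u assume u: "u \<in> \<D>"
    have [measurable]: "g \<in> borel_measurable borel" "kernel u \<in> borel_measurable borel"
      using spaceD(3)[OF g] kernel_measurable[OF u] by auto
    have [measurable]: "comp_op \<Phi> (kernel u) \<in> borel_measurable borel"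
      by (intro extension_measurable comp_op_holomorphic kernel_holomorphic u \<Phi>) simp
    have "(\<lambda>n. (LINT z|M. g z * cnj (\<phi> z) ^ n) / of_real (moment n) * u ^ n)
       sums (LINT z|M. g z * cnj (kernel u (\<phi> z)))"
      by (rule integral_kernel_sums[OF spaceD(5)[OF g] \<phi>m \<phi>D u])
    moreover have "(LINT z|M. g z * cnj (kernel u (\<phi> z))) = F u"
      unfolding F_def bergman_inner_def
      by (rule integral_cong_disc) (simp add: comp_op_def \<phi>_def, measurable)
    ultimately show "(\<lambda>n. (LINT z|M. g z * cnj (\<phi> z) ^ n) / of_real (moment n) * (u - 0) ^ n) sums F u"
      by simp
  qed
  \<comment> \<open>At u = \<Psi> v the composed kernel is T (K v), so the isometry gives K 0 v =
    1.\<close>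
  have F_\<Psi>: "F (\<Psi> v) = 1" if v: "v \<in> \<D>" for v
    using inner_T_kernel[of 0 v] v by (simp add: F_def g_def T_kernel kernel_0)
  have "open (\<Psi> ` \<D>)"
    by (rule open_mapping_thm[OF \<Psi>(1) _ _ _ _ \<Psi>_nonconstant]) auto
  then have F1: "F u = 1" if "u \<in> \<D>" for u
    by (rule analytic_continuation_open[of "\<Psi> ` \<D>" \<D> F "\<lambda>_. 1"])
      (use that maps F_hol F_\<Psi> in auto)
  have k0: "comp_op \<Phi> (kernel 0) = kernel 0"
    using maps(1) by (auto simp: comp_op_def kernel_0)
  have "bergman_inner \<alpha> g (kernel 0) = 1"
    using F1[of 0] by (simp add: F_def k0)
  moreover have "(bergman_norm \<alpha> g)\<^sup>2 = 1"
    using F1[OF a] by (simp add: norm_square_inner F_def g_eq[symmetric])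
  moreover have "(bergman_norm \<alpha> (kernel 0))\<^sup>2 = 1"
    by (simp add: norm_square_inner inner_one_one)
  \<comment> \<open>The squared distance from g to 1 is 1 - 2 + 1.\<close>
  ultimately have "(bergman_norm \<alpha> (\<lambda>z. g z + (-1) * kernel 0 z))\<^sup>2 = 0"
    using norm_lincomb[OF g kernel_in_space, of 0 "-1"] by simp
  then have "g z + (-1) * kernel 0 z = 0" for z
    by (intro norm_zero_imp[where f = "\<lambda>z. g z + (-1) * kernel 0 z"] space_lincomb g kernel_in_space) simp_all
  then have "g z = kernel 0 z" for z by (simp add: eq_neg_iff_add_eq_0[symmetric])
  then have \<Phi>k: "kernel a (\<Phi> z) = 1" if "z \<in> \<D>" for z
    using that g_eq by (metis comp_op_apply kernel_0)
  \<comment> \<open>So far \<open>kernel a\<close> is known to be 1 only at values of \<Phi>; the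
    identity theorem extends this to the disc.\<close>
  have "open (\<Phi> ` \<D>)"
    by (rule open_mapping_thm[OF \<Phi>(1) _ _ _ _ \<Phi>_nonconstant]) auto
  then have "kernel a u = 1" if "u \<in> \<D>" for u
    by (rule analytic_continuation_open[of "\<Phi> ` \<D>" \<D> "kernel a" "\<lambda>_. 1"])
      (use that maps \<Phi>k kernel_holomorphic[OF a] in auto)
  then have "kernel a = kernel 0" by (auto simp: fun_eq_iff kernel_0)
  then show ?thesis using kernel_eq_one_imp[OF a] by (simp add: a_def)
qed

text \<open>Pairing with z reads off the derivative at 0 times \<open>moment 1\<close>. As \<Psi>
  fixes 0, the chain rule multiplies that derivative by \<Psi>' 0, which moves to the second slot as
  its conjugate.\<close>

lemma adjoint_coord: "adjoint_rel (comp_op \<Psi>) coord (\<lambda>z. cnj (deriv \<Psi> 0) * coord z)"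
  unfolding adjoint_rel_def
proof (intro conjI ballI)
  define d where "d = deriv \<Psi> 0"
  \<comment> \<open>The zero summand puts a scalar multiple into the shape of
    \<open>space_lincomb\<close>.\<close>
  have "(\<lambda>z. 0 * kernel 0 z + cnj d * coord z) \<in> bergman_space \<alpha>"
    by (intro space_lincomb coord_in_space)
      (rule bounded_in_space[where B = 0], auto)
  then show "(\<lambda>z. cnj (deriv \<Psi> 0) * coord z) \<in> bergman_space \<alpha>" by (simp add: d_def)
  fix h assume h: "h \<in> bergman_space \<alpha>"
  have "deriv (comp_op \<Psi> h) 0 = deriv (h \<circ> \<Psi>) 0"
    by (rule complex_derivative_transform_within_open[of _ \<D>])
      (use comp_op_holomorphic[OF spaceD(1)[OF h] \<Psi>]
         holomorphic_on_compose_gen[OF \<Psi>(1) spaceD(1)[OF h] image_subsetI[OF maps(2)]] in \<open>simp_all add: comp_op_apply\<close>)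
  also have "\<dots> = deriv h (\<Psi> 0) * deriv \<Psi> 0"
    by (rule deriv_chain)
      (use \<Psi>(1) spaceD(1)[OF h] \<Psi>_0 in \<open>auto intro: holomorphic_on_imp_differentiable_at\<close>)
  finally have dc: "deriv (comp_op \<Psi> h) 0 = d * deriv h 0" by (simp add: \<Psi>_0 d_def)
  have "bergman_inner \<alpha> (comp_op \<Psi> h) coord = deriv (comp_op \<Psi> h) 0 * of_real (moment 1)"
    by (intro inner_coord comp_op_holomorphic integrable_comp_op alpha spaceD[OF h] \<Psi>)
  also have "\<dots> = d * bergman_inner \<alpha> h coord"
    by (simp add: dc inner_coord[OF spaceD(1,5)[OF h]])
  also have "\<dots> = (LINT z|M. d * (h z * cnj (coord z)))"
    unfolding bergman_inner_def by (rule integral_mult_right_zero[symmetric])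
  also have "\<dots> = bergman_inner \<alpha> h (\<lambda>z. cnj (deriv \<Psi> 0) * coord z)"
    unfolding bergman_inner_def by (simp add: d_def mult_ac)
  finally show "bergman_inner \<alpha> (comp_op \<Psi> h) coord = bergman_inner \<alpha> h (\<lambda>z. cnj (deriv \<Psi> 0) * coord z)" .
qed

lemma rotations: "is_rotation \<Phi>" "is_rotation \<Psi>"
proof -
  define d where "d = deriv \<Psi> 0"
  have no: "cmod (\<Psi> z) < 1" if "cmod z < 1" for z using maps(2)[of z] that by simp
  have Tc: "T coord = (\<lambda>z. cnj d * comp_op \<Phi> coord z)"
    unfolding T_eq[OF adjoint_coord] by (auto simp: comp_op_def d_def)
  have Tk: "T (kernel 0) = kernel 0"
    using maps(1) by (auto simp: T_kernel \<Psi>_0 comp_op_def kernel_0)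
  have "(bergman_norm \<alpha> (T coord))\<^sup>2 = (cmod d)\<^sup>2 * (bergman_norm \<alpha> (comp_op \<Phi> coord))\<^sup>2"
    unfolding norm_square Tc by (simp add: norm_mult power_mult_distrib)
  then have prod: "(cmod d)\<^sup>2 * (bergman_norm \<alpha> (comp_op \<Phi> coord))\<^sup>2 = moment 1"
    by (simp add: T_norm[OF coord_in_space] norm_coord)
  have "bergman_inner \<alpha> (T coord) (T (kernel 0)) = bergman_inner \<alpha> coord (kernel 0)"
  proof (rule isometry_inner[OF isometry_T coord_in_space kernel_in_space])
    have "\<forall>z\<in>\<D>. cmod (coord z) \<le> 1" "\<forall>z\<in>\<D>. cmod (kernel 0 z) \<le> 1"
      by (auto simp: coord_def kernel_0)
    from T_lincomb[OF coord_in_space kernel_in_space this adjoint_coord adjoint_kernel[OF \<Psi>]]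
    show "T (\<lambda>z. coord z + c * kernel 0 z) = (\<lambda>z. T coord z + c * T (kernel 0) z)" for c
      by simp
  qed simp
  then have "T coord 0 = 0"
    unfolding Tk inner_kernel_0[OF T_in_space[OF coord_in_space]] inner_kernel_0[OF coord_in_space]
    by (simp add: coord_def)
  \<comment> \<open>The product in \<open>prod\<close> is the positive \<open>moment 1\<close>, so d
    can be cancelled from T z at 0, which is cnj d * \<Phi> 0.\<close>
  moreover have "d \<noteq> 0" using prod by auto
  ultimately have \<Phi>_0: "\<Phi> 0 = 0"
    using maps(1)[of 0] by (simp add: Tc comp_op_def coord_def)
  have d1: "(cmod d)\<^sup>2 \<le> 1"
    using Schwarz_Lemma(2)[OF \<Psi>(1) \<Psi>_0 no, of 0] by (simp add: d_def power_le_one)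
  define N where "N = (bergman_norm \<alpha> (comp_op \<Phi> coord))\<^sup>2"
  have N: "0 \<le> N" "N \<le> moment 1"
    using rotation_if_norm_preserved(1)[OF \<Phi> \<Phi>_0] by (simp_all add: N_def)
  \<comment> \<open>Schwarz bounds |d|^2 by 1 and N by \<open>moment 1\<close>; as their product is
    \<open>moment 1\<close>, both bounds are attained, one for each map.\<close>
  have "moment 1 \<le> N" using prod d1 N mult_right_mono[of "(cmod d)\<^sup>2" 1 N] by (simp add: N_def)
  then have N1: "N = moment 1" using N by simp
  then show "is_rotation \<Phi>"
    using rotation_if_norm_preserved(2)[OF \<Phi> \<Phi>_0] by (simp add: N_def)
  have "(cmod d)\<^sup>2 = 1" using prod N1 moment_nonzero[of 1] by (simp add: N_def)
  then have "cmod (deriv \<Psi> 0) = 1" 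
    by (intro power2_eq_imp_eq[where y = 1]) (simp_all add: d_def)
  then show "is_rotation \<Psi>"
    using Schwarz_Lemma(3)[OF \<Psi>(1) \<Psi>_0 no, of 0] unfolding is_rotation_def by auto
qed

end

theorem theorem2p2:
  fixes \<alpha> :: real and \<Phi> \<Psi> :: "complex \<Rightarrow> complex"
  assumes "\<alpha> > -1"
    and "\<Phi> holomorphic_on \<D>" and "\<Phi> \<in> \<D> \<rightarrow> \<D>"
    and "\<Psi> holomorphic_on \<D>" and "\<Psi> \<in> \<D> \<rightarrow> \<D>"
  shows "(bergman_isometry \<alpha> (comp_op \<Phi> \<circ> bergman_adjoint \<alpha> (comp_op \<Psi>)) \<longleftrightarrow>
            bergman_isometry \<alpha> (comp_op \<Phi>) \<and> bergman_isometry \<alpha> (comp_op \<Psi>)) \<and>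
         (bergman_isometry \<alpha> (comp_op \<Phi> \<circ> bergman_adjoint \<alpha> (comp_op \<Psi>)) \<longleftrightarrow>
            is_rotation \<Phi> \<and> is_rotation \<Psi>)"
proof -
  interpret bergman_weight \<alpha> by standard fact
  have "bergman_isometry \<alpha> (comp_op \<Phi> \<circ> bergman_adjoint \<alpha> (comp_op \<Psi>)) \<longleftrightarrow>
      is_rotation \<Phi> \<and> is_rotation \<Psi>"
  proof
    assume "bergman_isometry \<alpha> (comp_op \<Phi> \<circ> bergman_adjoint \<alpha> (comp_op \<Psi>))"
    then interpret product_isometry \<alpha> \<Phi> \<Psi> by unfold_locales (use assms in auto)
    show "is_rotation \<Phi> \<and> is_rotation \<Psi>" using rotations by blast
  qed (auto intro: rotations_imp_product_isometry)
  moreover have "is_rotation \<Phi> \<longleftrightarrow> bergman_isometry \<alpha> (comp_op \<Phi>)"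
    "is_rotation \<Psi> \<longleftrightarrow> bergman_isometry \<alpha> (comp_op \<Psi>)"
    using assms isometry_imp_rotation rotation_imp_isometry by blast+
  ultimately show ?thesis by blast
qed

end
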